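(* For each hyperarithmetical set $C\subseteq\mathbb{N}$ there is a computable norm on $N$ such that $C$ is $m$-reducible to the set of triples of vectors in $N$ such that the three corresponding closed balls with radius $1$ (centered at these vectors) have a nonempty intersection in the completion of $N$.
   Context: $N$ (not to be confused with $\mathbb{N}$) is the vector space over $\mathbb{Q}$ of all functions $\mathbb{N}\to\mathbb{Q}$ with finite support, coded effectively by natural numbers. Here norms on $N$ may be real valued; a norm $\|\cdot\|$ on $N$ (positive definite, satisfying the norm axioms over $\mathbb{Q}$) is computable if the real number $\|v\|$ is computable uniformly in $v\in N$. The completion of $N$ under the norm is a real Banach space. Hyperarithmetical sets are the $\Delta^1_1$ subsets of $\mathbb{N}$. $C$ is $m$-reducible to a set $T$ of (coded) triples if there is a total computable function $r$ with $n\in C\Leftrightarrow r(n)\in T$ for all $n\in\mathbb{N}$. *)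

theory Defs
  imports "HOL-Analysis.Analysis" "HOL-Library.Poly_Mapping" "HOL-Library.Countable"
    "HOL-Library.Nat_Bijection"
begin

section \<open>Computable functions\<close>

text \<open>
  Programs for the partial recursive functions. A program acts on argument lists and is not tied
  to an arity; \<open>PrimRec\<close> recurses on the first argument, \<open>Mu\<close> searches for the least first argument
  at which the program returns 0.
\<close>

datatype prog = Zero | Succ | Proj nat | Comp prog "prog list" | PrimRec prog prog | Mu prog

inductive evals :: "prog \<Rightarrow> nat list \<Rightarrow> nat \<Rightarrow> bool" where
  Zero: "evals Zero xs 0"
| Succ: "evals Succ [x] (Suc x)"
| Proj: "i < length xs \<Longrightarrow> evals (Proj i) xs (xs ! i)"
| Comp: "length ys = length gs \<Longrightarrow> (\<And>i. i < length gs \<Longrightarrow> evals (gs ! i) xs (ys ! i)) \<Longrightarrow>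
    evals f ys z \<Longrightarrow> evals (Comp f gs) xs z"
| PrimRec_0: "evals f xs y \<Longrightarrow> evals (PrimRec f g) (0 # xs) y"
| PrimRec_Suc: "evals (PrimRec f g) (n # xs) y \<Longrightarrow> evals g (n # y # xs) z \<Longrightarrow>
    evals (PrimRec f g) (Suc n # xs) z"
| Mu: "evals f (n # xs) 0 \<Longrightarrow> (\<And>m. m < n \<Longrightarrow> \<exists>y. evals f (m # xs) (Suc y)) \<Longrightarrow>
    evals (Mu f) xs n"

inductive_cases evals_elims:
  "evals Zero xs z" "evals Succ xs z" "evals (Proj i) xs z" "evals (Comp f gs) xs z"
  "evals (PrimRec f g) (0 # xs) z" "evals (PrimRec f g) (Suc n # xs) z" "evals (Mu f) xs z"

lemma evals_deterministic: "evals c xs y \<Longrightarrow> evals c xs z \<Longrightarrow> y = z"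
proof (induction arbitrary: z rule: evals.induct)
  case (Comp ys gs xs f y)
  from Comp.prems obtain ys' where ys': "length ys' = length gs"
    "\<And>i. i < length gs \<Longrightarrow> evals (gs ! i) xs (ys' ! i)" "evals f ys' z"
    by (rule evals_elims(4)) blast
  have "ys = ys'"
    by (rule nth_equalityI) (use Comp.hyps(1) Comp.IH(1) ys'(1,2) in simp_all)
  with Comp.IH(2) ys'(3) show ?case by blast
next
  case (PrimRec_Suc f g n xs y z z')
  from PrimRec_Suc.prems show ?case
    by (rule evals_elims(6)) (use PrimRec_Suc.IH in blast)
next
  case (Mu f n xs)
  from Mu.prems have z: "evals f (z # xs) 0" "\<And>m. m < z \<Longrightarrow> \<exists>y. evals f (m # xs) (Suc y)"
    by (rule evals_elims(7), blast)+
  show ?case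
  proof (cases n z rule: linorder_cases)
    case less
    then obtain y where "evals f (n # xs) (Suc y)" using z(2) by blast
    then show ?thesis using Mu.IH(1) by blast
  next
    case greater
    then show ?thesis using Mu.IH(2)[of z] z(1) by blast
  qed
qed (blast elim: evals_elims)+

definition computable1 :: "(nat \<Rightarrow> nat) \<Rightarrow> bool" where
  "computable1 f \<longleftrightarrow> (\<exists>c. \<forall>x. evals c [x] (f x))"

definition computable2 :: "(nat \<Rightarrow> nat \<Rightarrow> nat) \<Rightarrow> bool" where
  "computable2 f \<longleftrightarrow> (\<exists>c. \<forall>x y. evals c [x, y] (f x y))"

definition decidable2 :: "(nat \<Rightarrow> nat \<Rightarrow> bool) \<Rightarrow> bool" where
  "decidable2 R \<longleftrightarrow> computable2 (\<lambda>x y. if R x y then 1 else 0)"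

definition m_reducible :: "nat set \<Rightarrow> nat set \<Rightarrow> bool" where
  "m_reducible A B \<longleftrightarrow> (\<exists>r. computable1 r \<and> (\<forall>n. n \<in> A \<longleftrightarrow> r n \<in> B))"


section \<open>Hyperarithmetical sets\<close>

text \<open>
  The lightface pointclasses. An effectively open subset of \<open>\<nat> \<times> \<nat>\<^sup>\<nat>\<close> is a union of a computable
  family of basic neighbourhoods, the basic neighbourhoods being given by the finite initial
  segments \<open>f 0, \<dots>, f (k - 1)\<close>. A set of numbers is \<open>\<Sigma>\<^sup>1\<^sub>1\<close> if it is the projection along Baire space
  of an effectively closed set.
\<close>

definition Sigma01 :: "(nat \<times> (nat \<Rightarrow> nat)) set \<Rightarrow> bool" where
  "Sigma01 P \<longleftrightarrow>
    (\<exists>R. decidable2 R \<and> P = {(n, f). \<exists>k. R n (list_encode (map f [0..<k]))})"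

definition Pi01 :: "(nat \<times> (nat \<Rightarrow> nat)) set \<Rightarrow> bool" where
  "Pi01 P \<longleftrightarrow> Sigma01 (- P)"

definition Sigma11 :: "nat set \<Rightarrow> bool" where
  "Sigma11 A \<longleftrightarrow> (\<exists>P. Pi01 P \<and> A = {n. \<exists>f. (n, f) \<in> P})"

definition Pi11 :: "nat set \<Rightarrow> bool" where
  "Pi11 A \<longleftrightarrow> Sigma11 (- A)"

definition hyperarithmetical :: "nat set \<Rightarrow> bool" where
  "hyperarithmetical A \<longleftrightarrow> Sigma11 A \<and> Pi11 A"


section \<open>Computable norms on the finitely supported rational sequences\<close>

type_synonym qvec = "nat \<Rightarrow>\<^sub>0 rat"

definition scale :: "rat \<Rightarrow> qvec \<Rightarrow> qvec" where
  "scale c v = Poly_Mapping.map ((*) c) v"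

text \<open>
  The number \<open>n\<close>, read as a list of codes of rationals, codes the vector with these initial
  coordinates followed by zeros. Every vector has a code, but not a unique one; equality of the
  coded vectors is decidable, so an injective effective coding would give the same notions.
\<close>

definition vec_decode :: "nat \<Rightarrow> qvec" where
  "vec_decode n = Poly_Mapping.nth (map nat_to_rat_surj (list_decode n))"

lemma surj_vec_decode: "surj vec_decode"
proof (rule surjI)
  fix v :: qvec
  have "map (nat_to_rat_surj \<circ> inv nat_to_rat_surj) qs = qs" for qs
    by (induction qs) (auto simp: surj_f_inv_f surj_nat_to_rat_surj)
  then show "vec_decode (list_encode (map (inv nat_to_rat_surj)
      (map (Poly_Mapping.lookup v) [0..<Poly_Mapping.degree v]))) = v"
    by (simp only: vec_decode_def list_encode_inverse map_map[of nat_to_rat_surj] Poly_Mapping.nth_idem)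
qed

definition is_norm :: "(qvec \<Rightarrow> real) \<Rightarrow> bool" where
  "is_norm p \<longleftrightarrow>
    (\<forall>v. 0 \<le> p v) \<and> (\<forall>v. p v = 0 \<longleftrightarrow> v = 0) \<and>
    (\<forall>c v. p (scale c v) = \<bar>of_rat c\<bar> * p v) \<and>
    (\<forall>u v. p (u + v) \<le> p u + p v)"

definition computable_norm :: "(qvec \<Rightarrow> real) \<Rightarrow> bool" where
  "computable_norm p \<longleftrightarrow> is_norm p \<and>
    (\<exists>q. computable2 q \<and>
      (\<forall>n k. \<bar>p (vec_decode n) - of_rat (nat_to_rat_surj (q n k))\<bar> \<le> 1 / 2 ^ k))"


section \<open>The completion\<close>

text \<open>
  Points of the completion are the Cauchy sequences modulo null sequences. Only its metric is
  defined here, since closed balls do not involve the vector space structure.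
\<close>

definition norm_dist :: "(qvec \<Rightarrow> real) \<Rightarrow> qvec \<Rightarrow> qvec \<Rightarrow> real" where
  "norm_dist p u v = p (u - v)"

definition cauchy_seqs :: "(qvec \<Rightarrow> real) \<Rightarrow> (nat \<Rightarrow> qvec) set" where
  "cauchy_seqs p = {x. Metric_space.MCauchy UNIV (norm_dist p) x}"

definition null_rel :: "(qvec \<Rightarrow> real) \<Rightarrow> ((nat \<Rightarrow> qvec) \<times> (nat \<Rightarrow> qvec)) set" where
  "null_rel p = {(x, y). x \<in> cauchy_seqs p \<and> y \<in> cauchy_seqs p \<and>
    (\<lambda>n. norm_dist p (x n) (y n)) \<longlonglongrightarrow> 0}"

definition norm_completion :: "(qvec \<Rightarrow> real) \<Rightarrow> (nat \<Rightarrow> qvec) set set" where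
  "norm_completion p = cauchy_seqs p // null_rel p"

text \<open>The library's metric spaces require the distance to be nonnegative and symmetric off the carrier too.\<close>

definition completion_dist ::
  "(qvec \<Rightarrow> real) \<Rightarrow> (nat \<Rightarrow> qvec) set \<Rightarrow> (nat \<Rightarrow> qvec) set \<Rightarrow> real" where
  "completion_dist p X Y =
    (if X \<in> norm_completion p \<and> Y \<in> norm_completion p
     then THE d. \<forall>x\<in>X. \<forall>y\<in>Y. (\<lambda>n. norm_dist p (x n) (y n)) \<longlonglongrightarrow> d
     else 0)"

definition completion_embed :: "(qvec \<Rightarrow> real) \<Rightarrow> qvec \<Rightarrow> (nat \<Rightarrow> qvec) set" where
  "completion_embed p v = null_rel p `` {\<lambda>_. v}"

definition unit_cball :: "(qvec \<Rightarrow> real) \<Rightarrow> qvec \<Rightarrow> (nat \<Rightarrow> qvec) set set" where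
  "unit_cball p v = Metric_space.mcball (norm_completion p) (completion_dist p) (completion_embed p v) 1"

definition triple_decode :: "nat \<Rightarrow> qvec \<times> qvec \<times> qvec" where
  "triple_decode t =
    (let (a, s) = prod_decode t; (b, c) = prod_decode s
     in (vec_decode a, vec_decode b, vec_decode c))"

definition meeting_triples :: "(qvec \<Rightarrow> real) \<Rightarrow> (qvec \<times> qvec \<times> qvec) set" where
  "meeting_triples p =
    {(u, v, w). unit_cball p u \<inter> unit_cball p v \<inter> unit_cball p w \<noteq> {}}"

end

theory Submission
  imports Defs
begin

text \<open>
  A \<open>\<Sigma>\<^sup>1\<^sub>1\<close> description of \<open>C\<close> gives a decidable relation \<open>R\<close> such that \<open>n \<in> C\<close> iff some \<open>f\<close> has no
  initial segment in \<open>R n\<close>. So membership in \<open>C\<close> is the existence of an infinite path, starting at a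
  root that depends on \<open>n\<close>, in one decidable forest. The existence of a path from \<open>r\<close> is a question
  about convex sets in \<open>\<ell>\<^sub>1\<close>: there is a path iff there is a summable \<open>x \<ge> 0\<close> on the nodes with
  \<open>x\<^sub>r \<ge> 1/8\<close> and \<open>x\<^sub>s \<le> 2 \<Sum>\<^sub>j x\<^sub>j\<close> for every node \<open>s\<close>, where \<open>j\<close> runs through the children of \<open>s\<close>.
  Indeed each node at which such an \<open>x\<close> is positive has a child at which \<open>x\<close> is positive; conversely the
  weights \<open>1/8, 1/16, 1/32, \<dots>\<close> along a path are such an \<open>x\<close>. Finitely supported \<open>x\<close> never satisfy
  the inequalities, which is why the completion matters.

  The solution set is the intersection of two closed convex cones, one of them translated, and these have
  to become faces of a unit ball. For this two coordinates \<open>a\<close>, \<open>b\<close> are added to \<open>x\<close>. With \<open>deficit x = \<Sum>\<^sub>s max 0 (- x\<^sub>s)\<close> and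
  \<open>excess x = \<Sum>\<^sub>s max 0 (x\<^sub>s - 2 \<Sum>\<^sub>j x\<^sub>j)\<close>, put
  \<open>gauge v = max {deficit x + a, excess x + b, - a - b}\<close> and \<open>\<parallel>v\<parallel> = max {gauge v, gauge (- v)}\<close>.
  The three linear forms \<open>a\<close>, \<open>b\<close>, \<open>- a - b\<close> add up to zero. The three centres have \<open>(a, b)\<close>-parts
  \<open>(-1, 1/2)\<close>, \<open>(1/2, -1)\<close>, \<open>(1/2, 1/2)\<close>, so that each form takes the value \<open>-1\<close> at one of them; then a point of
  all three balls has all three forms \<open>\<le> 0\<close>, that is \<open>a = b = 0\<close>. At such a point the first ball says
  \<open>deficit (x - u) \<le> 0\<close>, where \<open>u\<close> is the forest part of its centre, and the second says \<open>excess x \<le> 0\<close>.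
  With \<open>u = e\<^sub>r / 8\<close> these are exactly the inequalities above, and for \<open>x\<close> of small \<open>\<ell>\<^sub>1\<close>-norm all the other
  constraints hold. This is the content of the lemmas \<open>path_if_meeting\<close> and \<open>meeting_if_path\<close>.

  The norm takes rational values on \<open>N\<close>. After bringing the coordinates of a vector to a common denominator, its value
  is obtained from natural numbers by bounded sums and truncated subtraction (\<open>gauge_eq_nat_gauge\<close>),
  so it is computable when the forest is decidable.
\<close>

section \<open>Closure properties of the computable functions\<close>

text \<open>
  Computability of a function of an environment \<open>e\<close> whose numerical entries are \<open>vs e\<close>. Keeping the
  type of environments arbitrary gives closure rules that serve functions of every arity, and they
  can be applied backwards to a \<open>\<lambda>\<close>-term: a bounded variable only prepends an entry to \<open>vs\<close>.
\<close>
definition computable_on :: "('e \<Rightarrow> nat list) \<Rightarrow> ('e \<Rightarrow> nat) \<Rightarrow> bool" where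
  "computable_on vs F \<longleftrightarrow> (\<exists>c. \<forall>e. evals c (vs e) (F e))"

text \<open>
  Needed wherever a program has to copy its whole environment, since a program is not tied to an arity.
\<close>
definition fixed_length :: "('e \<Rightarrow> 'a list) \<Rightarrow> bool" where
  "fixed_length vs \<longleftrightarrow> (\<exists>k. \<forall>e. length (vs e) = k)"

lemma fixed_length_Nil: "fixed_length (\<lambda>e. [])"
  and fixed_length_Cons: "fixed_length w \<Longrightarrow> fixed_length (\<lambda>e. a e # w e)"
  by (auto simp: fixed_length_def)

lemma list_eq_map_nth: "length xs = k \<Longrightarrow> xs = map (\<lambda>i. xs ! i) [0..<k]"
  by (auto intro: nth_equalityI)

lemma computable1_iff: "computable1 f \<longleftrightarrow> computable_on (\<lambda>x. [x]) f"
  by (simp add: computable1_def computable_on_def)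

lemma computable2_iff:
  "computable2 f \<longleftrightarrow> computable_on (\<lambda>p. [fst p, snd p]) (\<lambda>p. f (fst p) (snd p))"
  by (simp add: computable2_def computable_on_def)

lemma computable_on_nth: "(\<And>e. i < length (vs e)) \<Longrightarrow> computable_on vs (\<lambda>e. vs e ! i)"
  unfolding computable_on_def by (intro exI[of _ "Proj i"]) (auto intro: evals.Proj)

lemma computable_on_var0: "computable_on (\<lambda>e. a e # w e) a"
  using computable_on_nth[of 0 "\<lambda>e. a e # w e"] by simp

lemma computable_on_var1: "computable_on (\<lambda>e. b e # a e # w e) a"
  using computable_on_nth[of 1 "\<lambda>e. b e # a e # w e"] by simp

lemma computable_on_var2: "computable_on (\<lambda>e. c e # b e # a e # w e) a"
  using computable_on_nth[of 2 "\<lambda>e. c e # b e # a e # w e"] by simp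

text \<open>
  All rules for composition and for reindexing environments are instances of this one.
\<close>
lemma computable_on_subst:
  assumes G: "computable_on ws G"
    and ws: "\<And>e. ws (h e) = map (\<lambda>v. v e) Vs"
    and Vs: "\<And>v. v \<in> set Vs \<Longrightarrow> computable_on vs v"
  shows "computable_on vs (\<lambda>e. G (h e))"
proof -
  obtain c where c: "\<And>e. evals c (ws e) (G e)"
    using G unfolding computable_on_def by blast
  have "\<forall>v \<in> set Vs. \<exists>d. \<forall>e. evals d (vs e) (v e)"
    using Vs unfolding computable_on_def by blast
  then obtain d where d: "\<And>v e. v \<in> set Vs \<Longrightarrow> evals (d v) (vs e) (v e)"
    by (auto dest!: bchoice)
  have "evals (Comp c (map d Vs)) (vs e) (G (h e))" for e
    by (rule evals.Comp[where ys = "map (\<lambda>v. v e) Vs"]) (use c[of "h e"] ws[of e] d in auto)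
  then show ?thesis unfolding computable_on_def by blast
qed

lemma computable_on_comp1:
  assumes "computable1 g" "computable_on vs F"
  shows "computable_on vs (\<lambda>e. g (F e))"
  by (rule computable_on_subst[OF assms(1)[unfolded computable1_iff], where Vs = "[F]"])
    (use assms(2) in auto)

lemma computable_on_comp2:
  assumes "computable2 g" "computable_on vs F" "computable_on vs G"
  shows "computable_on vs (\<lambda>e. g (F e) (G e))"
  using computable_on_subst[OF assms(1)[unfolded computable2_iff], where Vs = "[F, G]" and vs = vs
    and h = "\<lambda>e. (F e, G e)"] assms(2,3)
  by auto

lemma computable_on_Suc: "computable_on vs F \<Longrightarrow> computable_on vs (\<lambda>e. Suc (F e))"
  by (rule computable_on_comp1) (auto simp: computable1_def intro: evals.Succ)

lemma computable_on_const: "computable_on vs (\<lambda>e. n)"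
proof (induction n)
  case 0
  show ?case unfolding computable_on_def by (intro exI[of _ Zero]) (auto intro: evals.Zero)
next
  case (Suc n)
  then show ?case by (rule computable_on_Suc)
qed

text \<open>
  A program for primitive recursion reads the recursion argument from the front of its list. The bound \<open>N e\<close>
  is put there by a substitution.
\<close>
lemma computable_on_rec:
  assumes len: "fixed_length vs" and N: "computable_on vs N" and B: "computable_on vs B"
    and S: "computable_on (\<lambda>p. fst p # fst (snd p) # vs (snd (snd p)))
      (\<lambda>p. S (fst p) (fst (snd p)) (snd (snd p)))"
  shows "computable_on vs (\<lambda>e. rec_nat (B e) (\<lambda>m y. S m y e) (N e))"
proof -
  obtain k where k: "\<And>e. length (vs e) = k" using len unfolding fixed_length_def by blast
  obtain b where b: "\<And>e. evals b (vs e) (B e)" using B unfolding computable_on_def by blast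
  obtain s where s: "\<And>m y e. evals s (m # y # vs e) (S m y e)"
    using S unfolding computable_on_def by auto
  have rec: "evals (PrimRec b s) (n # vs e) (rec_nat (B e) (\<lambda>m y. S m y e) n)" for n e
    by (induction n) (auto intro: evals.PrimRec_0 evals.PrimRec_Suc b s)
  let ?R = "\<lambda>p. rec_nat (B (snd p)) (\<lambda>m y. S m y (snd p)) (fst p)"
  have R: "computable_on (\<lambda>p. fst p # vs (snd p)) ?R"
    unfolding computable_on_def using rec by auto
  have vs: "vs e = map (\<lambda>i. vs e ! i) [0..<k]" for e
    using k by (intro list_eq_map_nth)
  have "computable_on vs (\<lambda>e. ?R ((\<lambda>e. (N e, e)) e))"
  proof (rule computable_on_subst[OF R, where Vs = "N # map (\<lambda>i e. vs e ! i) [0..<k]"])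
    show "fst (N e, e) # vs (snd (N e, e)) = map (\<lambda>v. v e) (N # map (\<lambda>i e. vs e ! i) [0..<k])" for e
      using vs[of e] by (simp add: comp_def)
    show "computable_on vs v" if "v \<in> set (N # map (\<lambda>i e. vs e ! i) [0..<k])" for v
      using that N k by (auto intro: computable_on_nth)
  qed
  then show ?thesis by simp
qed

lemma computable2_add: "computable2 (+)"
proof -
  have "x + y = rec_nat x (\<lambda>m y. Suc y) y" for x y :: nat by (induction y) auto
  then show ?thesis unfolding computable2_iff
    by (simp only:) (intro computable_on_rec fixed_length_Nil fixed_length_Cons computable_on_Suc
      computable_on_var0 computable_on_var1)
qed

lemmas computable_on_add = computable_on_comp2[OF computable2_add]

lemma computable_on_shift:
  assumes len: "fixed_length vs" 
    and H: "computable_on (\<lambda>p. fst p # vs (snd p)) (\<lambda>p. H (fst p) (snd p))"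
  shows "computable_on (\<lambda>p. fst p # fst (snd p) # vs (snd (snd p))) (\<lambda>p. H (fst p) (snd (snd p)))"
proof -
  obtain k where k: "\<And>e. length (vs e) = k" using len unfolding fixed_length_def by blast
  let ?vs = "\<lambda>p. fst p # fst (snd p) # vs (snd (snd p))"
  have nth: "computable_on ?vs (\<lambda>p. vs (snd (snd p)) ! i)" if "i < k" for i
    using computable_on_nth[of "Suc (Suc i)" ?vs] that k by simp
  have vs: "vs e = map (\<lambda>i. vs e ! i) [0..<k]" for e
    using k by (intro list_eq_map_nth)
  let ?Vs = "fst # map (\<lambda>i p. vs (snd (snd p)) ! i) [0..<k]"
  have "computable_on ?vs (\<lambda>p. (\<lambda>p. H (fst p) (snd p)) ((\<lambda>p. (fst p, snd (snd p))) p))"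
  proof (rule computable_on_subst[OF H, where Vs = ?Vs])
    show "fst (fst p, snd (snd p)) # vs (snd (fst p, snd (snd p))) = map (\<lambda>v. v p) ?Vs"
      for p :: "nat \<times> nat \<times> 'a"
      using vs[of "snd (snd p)"] by (simp add: comp_def)
    show "computable_on ?vs v" if "v \<in> set ?Vs" for v
      using that nth by (auto intro: computable_on_var0)
  qed
  then show ?thesis by simp
qed

lemma computable_on_sum:
  assumes "fixed_length vs" "computable_on vs F"
    "computable_on (\<lambda>p. fst p # vs (snd p)) (\<lambda>p. H (fst p) (snd p))"
  shows "computable_on vs (\<lambda>e. \<Sum>i<F e. H i e)"
proof -
  have "(\<Sum>i<n. H i e) = rec_nat 0 (\<lambda>m y. y + H m e) n" for n e by (induction n) auto
  then show ?thesis
    by (simp only:) (intro computable_on_rec computable_on_add computable_on_const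
      computable_on_var1 computable_on_shift assms)
qed

lemma computable_on_mult:
  "computable_on vs F \<Longrightarrow> computable_on vs G \<Longrightarrow> computable_on vs (\<lambda>e. F e * G e)"
proof -
  have "computable_on (\<lambda>p. [fst p, snd p]) (\<lambda>p. \<Sum>i<fst p. snd p)"
    by (intro computable_on_sum fixed_length_Nil fixed_length_Cons computable_on_var0 computable_on_var2)
  then have "computable2 (*)" by (simp add: computable2_iff)
  then show "computable_on vs F \<Longrightarrow> computable_on vs G \<Longrightarrow> computable_on vs (\<lambda>e. F e * G e)"
    by (rule computable_on_comp2)
qed

lemma computable_on_prod:
  assumes "fixed_length vs" "computable_on vs F"
    "computable_on (\<lambda>p. fst p # vs (snd p)) (\<lambda>p. H (fst p) (snd p))"
  shows "computable_on vs (\<lambda>e. \<Prod>i<F e. H i e)"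
proof -
  have "(\<Prod>i<n. H i e) = rec_nat 1 (\<lambda>m y. y * H m e) n" for n e by (induction n) auto
  then show ?thesis
    by (simp only:) (intro computable_on_rec computable_on_mult computable_on_const
      computable_on_var1 computable_on_shift assms)
qed

lemma computable2_diff: "computable2 (-)"
proof -
  have pred: "computable1 (\<lambda>n. n - 1)"
  proof -
    have "n - 1 = rec_nat 0 (\<lambda>m y. m) n" for n :: nat by (cases n) auto
    then show ?thesis unfolding computable1_iff
      by (simp only:) (intro computable_on_rec fixed_length_Nil fixed_length_Cons
        computable_on_const computable_on_var0)
  qed
  have eq: "(\<lambda>p. fst p - snd p) = (\<lambda>p. rec_nat (fst p) (\<lambda>m y. y - 1) (snd p :: nat))"
  proof
    have "x - n = rec_nat x (\<lambda>m y. y - 1) n" for x n :: nat by (induction n) auto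
    then show "fst p - snd p = rec_nat (fst p) (\<lambda>m y. y - 1) (snd p)" for p :: "nat \<times> nat" .
  qed
  show ?thesis unfolding computable2_iff
    by (subst eq) (intro computable_on_rec fixed_length_Nil fixed_length_Cons
      computable_on_comp1[OF pred] computable_on_var0 computable_on_var1)
qed

lemmas computable_on_diff = computable_on_comp2[OF computable2_diff]

lemma computable_on_if_eq:
  assumes "computable_on vs F" "computable_on vs G" "computable_on vs A" "computable_on vs B"
  shows "computable_on vs (\<lambda>e. if F e = G e then A e else B e)"
proof -
  have "(if x = y then a else b) =
      (1 - ((x - y) + (y - x))) * a + (1 - (1 - ((x - y) + (y - x)))) * b" for x y a b :: nat
    by auto
  then show ?thesis
    by (simp only:) (intro computable_on_add computable_on_mult computable_on_diff
      computable_on_const assms)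
qed

lemma computable_on_funpow:
  assumes "computable1 g" "computable_on vs N" "computable_on vs F"
  shows "computable_on vs (\<lambda>e. (g ^^ N e) (F e))"
proof -
  have "(g ^^ n) x = rec_nat x (\<lambda>m y. g y) n" for n x by (induction n) auto
  then have "computable2 (\<lambda>n x. (g ^^ n) x)" unfolding computable2_iff
    by (simp only:) (intro computable_on_rec fixed_length_Nil fixed_length_Cons
      computable_on_comp1[OF assms(1)] computable_on_var0 computable_on_var1)
  from computable_on_comp2[OF this assms(2,3)] show ?thesis .
qed

lemmas computable_intros = fixed_length_Nil fixed_length_Cons computable_on_Suc
  computable_on_const computable_on_add computable_on_mult computable_on_diff computable_on_sum
  computable_on_prod computable_on_if_eq computable_on_var0 computable_on_var1 computable_on_var2

lemma computable_on_prod_encode: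
  "computable_on vs F \<Longrightarrow> computable_on vs G \<Longrightarrow> computable_on vs (\<lambda>e. prod_encode (F e, G e))"
proof -
  have "triangle n = (\<Sum>i<n. Suc i)" for n by (induction n) auto
  then have "prod_encode (x, y) = (\<Sum>i<x + y. Suc i) + x" for x y
    by (simp add: prod_encode_def)
  then have "computable2 (\<lambda>x y. prod_encode (x, y))"
    unfolding computable2_iff by (simp only:) (intro computable_intros)
  then show "computable_on vs F \<Longrightarrow> computable_on vs G \<Longrightarrow>
      computable_on vs (\<lambda>e. prod_encode (F e, G e))"
    by (rule computable_on_comp2)
qed

text \<open>
  Unpairing is a bounded search, because a pair dominates its components; the search is
  written as a sum in which a single term is nonzero.
\<close>
lemma computable1_prod_decode:
  "computable1 (\<lambda>n. fst (prod_decode n))" (is ?fst)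
  "computable1 (\<lambda>n. snd (prod_decode n))" (is ?snd)
proof -
  have eq: "f (prod_decode n) =
      (\<Sum>a<Suc n. \<Sum>b<Suc n. if prod_encode (a, b) = n then f (a, b) else 0)" for f n
  proof -
    obtain x y where n: "n = prod_encode (x, y)"
      by (metis prod_decode_inverse surj_pair)
    have "(\<Sum>a<Suc n. \<Sum>b<Suc n. if prod_encode (a, b) = n then f (a, b) else 0) =
        (\<Sum>p\<in>{..<Suc n} \<times> {..<Suc n}. if p = (x, y) then f p else 0)"
      unfolding n sum.cartesian_product by (intro sum.cong) (auto split: if_splits)
    also have "\<dots> = f (x, y)"
      using le_prod_encode_1[of x y] le_prod_encode_2[of y x] by (auto simp: n)
    finally show ?thesis by (simp add: n)
  qed
  show ?fst unfolding computable1_iff eq[of fst] fst_conv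
    by (intro computable_intros computable_on_prod_encode)
  show ?snd unfolding computable1_iff eq[of snd] snd_conv
    by (intro computable_intros computable_on_prod_encode)
qed

lemmas computable_on_prod_decode = computable1_prod_decode[THEN computable_on_comp1]

lemma prod_decode_0: "prod_decode 0 = (0, 0)"
  using prod_encode_inverse[of "(0, 0)"] by (simp add: prod_encode_def)

text \<open>
  The default values at \<open>0\<close> are harmless: \<open>0\<close> codes the empty list, and \<open>prod_decode 0 = (0, 0)\<close>.
\<close>
definition tl_code :: "nat \<Rightarrow> nat" where
  "tl_code n = snd (prod_decode (n - 1))"

lemma tl_code: "tl_code n = list_encode (tl (list_decode n))"
proof (cases n)
  case 0
  then show ?thesis by (simp add: tl_code_def prod_decode_0)
next
  case (Suc m)
  then show ?thesis by (cases "prod_decode m") (simp add: tl_code_def)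
qed

lemma tl_code_funpow: "(tl_code ^^ i) n = list_encode (drop i (list_decode n))"
  by (induction i) (simp_all add: tl_code drop_Suc tl_drop)

lemma computable1_tl_code: "computable1 tl_code"
proof -
  have "computable1 (\<lambda>n. snd (prod_decode (n - 1)))"
    unfolding computable1_iff by (intro computable_intros computable_on_prod_decode)
  then show ?thesis by (simp add: tl_code_def[abs_def])
qed

definition nth_code :: "nat \<Rightarrow> nat \<Rightarrow> nat" where
  "nth_code n i = fst (prod_decode ((tl_code ^^ i) n - 1))"

lemma nth_code: "nth_code n i = nth_default 0 (list_decode n) i"
proof -
  have hd: "fst (prod_decode (list_encode xs - 1)) = nth_default 0 xs 0" for xs
    by (cases xs) (simp_all add: prod_decode_0 nth_default_def)
  show ?thesis
    unfolding nth_code_def tl_code_funpow hd by (simp add: nth_default_def)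
qed

lemma computable_on_nth_code:
  "computable_on vs F \<Longrightarrow> computable_on vs G \<Longrightarrow> computable_on vs (\<lambda>e. nth_code (F e) (G e))"
  unfolding nth_code_def
  by (intro computable_intros computable_on_prod_decode computable_on_funpow computable1_tl_code)

definition length_code :: "nat \<Rightarrow> nat" where
  "length_code n = (\<Sum>i<n. if (tl_code ^^ i) n = 0 then 0 else 1)"

lemma length_list_decode_le: "length (list_decode n) \<le> n"
proof -
  have "length xs \<le> list_encode xs" for xs
    by (induction xs) (auto intro: le_trans[OF _ le_prod_encode_2])
  from this[of "list_decode n"] show ?thesis by simp
qed

lemma length_code: "length_code n = length (list_decode n)"
proof -
  have enc: "list_encode xs = 0 \<longleftrightarrow> xs = []" for xs by (cases xs) auto
  have "length_code n = (\<Sum>i<n. if i < length (list_decode n) then 1 else 0)"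
    unfolding length_code_def tl_code_funpow enc by (intro sum.cong) auto
  also have "\<dots> = card {i. i < n \<and> i < length (list_decode n)}"
    by (simp add: sum.If_cases Int_def)
  also have "{i. i < n \<and> i < length (list_decode n)} = {..<length (list_decode n)}"
    using length_list_decode_le[of n] by auto
  finally show ?thesis by simp
qed

lemma computable_on_length_code:
  "computable_on vs F \<Longrightarrow> computable_on vs (\<lambda>e. length_code (F e))"
proof -
  have "computable1 length_code"
    unfolding computable1_iff length_code_def[abs_def]
    by (intro computable_intros computable_on_funpow computable1_tl_code)
  then show "computable_on vs F \<Longrightarrow> computable_on vs (\<lambda>e. length_code (F e))"
    by (rule computable_on_comp1)
qed

section \<open>Balls in the completion of a normed space\<close>

lemma scale_minus_one: "scale (- 1) v = - v"
  by (rule poly_mapping_eqI) (simp add: scale_def Poly_Mapping.map.rep_eq when_def)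

text \<open>
  The completion consists of classes of Cauchy sequences. The aim of this part is to express the meeting
  of three balls by one Cauchy sequence of vectors, without reference to classes.
\<close>
context
  fixes p :: "qvec \<Rightarrow> real"
  assumes norm: "is_norm p"
begin

lemma norm_nonneg: "0 \<le> p v" and norm_eq_0_iff: "p v = 0 \<longleftrightarrow> v = 0"
  and norm_triangle: "p (u + v) \<le> p u + p v"
  using norm unfolding is_norm_def by auto

lemma norm_minus: "p (- v) = p v"
  using norm scale_minus_one[of v] unfolding is_norm_def by (metis abs_1 abs_minus_cancel mult_1 of_rat_1 of_rat_minus)

lemma norm_diff_commute: "p (u - v) = p (v - u)"
  using norm_minus[of "u - v"] by simp

lemma norm_diff_triangle: "p (u - w) \<le> p (u - v) + p (v - w)"
  using norm_triangle[of "u - v" "v - w"] by simp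

lemma Metric_space_norm_dist: "Metric_space UNIV (norm_dist p)"
  by unfold_locales
    (auto simp: norm_dist_def norm_nonneg norm_eq_0_iff norm_diff_commute norm_diff_triangle)

lemma cauchy_seqs_iff:
  "x \<in> cauchy_seqs p \<longleftrightarrow> (\<forall>\<epsilon>>0. \<exists>N. \<forall>n\<ge>N. \<forall>m\<ge>N. p (x n - x m) < \<epsilon>)"
  unfolding cauchy_seqs_def mem_Collect_eq Metric_space.MCauchy_def[OF Metric_space_norm_dist]
    norm_dist_def by auto

lemma const_in_cauchy_seqs: "(\<lambda>_. v) \<in> cauchy_seqs p"
  unfolding cauchy_seqs_iff by (simp add: norm_eq_0_iff[THEN iffD2])

lemma norm_dist_convergent:
  assumes "x \<in> cauchy_seqs p" "y \<in> cauchy_seqs p"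
  shows "convergent (\<lambda>n. norm_dist p (x n) (y n))"
proof -
  have "Cauchy (\<lambda>n. norm_dist p (x n) (y n))"
  proof (rule metric_CauchyI)
    fix \<epsilon> :: real assume "0 < \<epsilon>"
    then have e2: "0 < \<epsilon> / 2" by simp
    obtain N where N: "\<And>n m. n \<ge> N \<Longrightarrow> m \<ge> N \<Longrightarrow> p (x n - x m) < \<epsilon> / 2"
      using assms(1) e2 unfolding cauchy_seqs_iff by blast
    obtain M where M: "\<And>n m. n \<ge> M \<Longrightarrow> m \<ge> M \<Longrightarrow> p (y n - y m) < \<epsilon> / 2"
      using assms(2) e2 unfolding cauchy_seqs_iff by blast
    have le: "p (x n - y n) - p (x m - y m) \<le> p (x n - x m) + p (y n - y m)" for n m
      using norm_diff_triangle[of "x n" "y n" "x m"] norm_diff_triangle[of "x m" "y n" "y m"]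
        norm_diff_commute[of "y n" "y m"] by linarith
    have "dist (norm_dist p (x n) (y n)) (norm_dist p (x m) (y m)) < \<epsilon>"
      if "n \<ge> max N M" "m \<ge> max N M" for n m
      using that N[of n m] M[of n m] le[of n m] le[of m n] norm_diff_commute[of "x n" "x m"]
        norm_diff_commute[of "y n" "y m"]
      unfolding norm_dist_def dist_real_def by auto
    then show "\<exists>K. \<forall>n\<ge>K. \<forall>m\<ge>K.
        dist (norm_dist p (x n) (y n)) (norm_dist p (x m) (y m)) < \<epsilon>" by blast
  qed
  then show ?thesis by (simp add: Cauchy_convergent_iff)
qed

text \<open>
  The limit distance depends only on the classes, which makes the definite description in
  \<^const>\<open>completion_dist\<close> meaningful and also yields transitivity of \<^const>\<open>null_rel\<close>.
\<close>
lemma norm_dist_tendsto_cong: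
  assumes "(x, x') \<in> null_rel p" "(y, y') \<in> null_rel p"
    and d: "(\<lambda>n. norm_dist p (x n) (y n)) \<longlonglongrightarrow> d"
  shows "(\<lambda>n. norm_dist p (x' n) (y' n)) \<longlonglongrightarrow> d"
proof -
  have "(\<lambda>n. norm_dist p (x n) (x' n) + norm_dist p (y n) (y' n)) \<longlonglongrightarrow> 0 + 0"
    using assms by (intro tendsto_add) (auto simp: null_rel_def)
  then have lim: "(\<lambda>n. norm_dist p (x n) (x' n) + norm_dist p (y n) (y' n)) \<longlonglongrightarrow> 0" by simp
  have "(\<lambda>n. norm_dist p (x' n) (y' n) - norm_dist p (x n) (y n)) \<longlonglongrightarrow> 0"
  proof (rule Lim_null_comparison[OF _ lim])
    show "\<forall>\<^sub>F n in sequentially. norm (norm_dist p (x' n) (y' n) - norm_dist p (x n) (y n))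
        \<le> norm_dist p (x n) (x' n) + norm_dist p (y n) (y' n)"
    proof (intro always_eventually allI)
      fix n
      show "norm (norm_dist p (x' n) (y' n) - norm_dist p (x n) (y n))
        \<le> norm_dist p (x n) (x' n) + norm_dist p (y n) (y' n)"
        using norm_diff_triangle[of "x n" "y n" "x' n"] norm_diff_triangle[of "x' n" "y n" "y' n"]
          norm_diff_triangle[of "x' n" "y' n" "x n"] norm_diff_triangle[of "x n" "y' n" "y n"]
          norm_diff_commute[of "x n" "x' n"] norm_diff_commute[of "y n" "y' n"]
        unfolding norm_dist_def real_norm_def by linarith
    qed
  qed
  from tendsto_add[OF this d] show ?thesis by simp
qed

lemma equiv_null_rel: "equiv (cauchy_seqs p) (null_rel p)"
proof (rule equivI)
  show "null_rel p \<subseteq> cauchy_seqs p \<times> cauchy_seqs p" by (auto simp: null_rel_def)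
  show refl: "refl_on (cauchy_seqs p) (null_rel p)"
    by (auto simp: refl_on_def null_rel_def norm_dist_def norm_eq_0_iff[THEN iffD2])
  show "sym (null_rel p)"
    by (auto simp: sym_def null_rel_def norm_dist_def norm_diff_commute)
  show "trans (null_rel p)"
  proof (rule transI)
    fix x y z assume xy: "(x, y) \<in> null_rel p" and yz: "(y, z) \<in> null_rel p"
    have "(x, x) \<in> null_rel p" using xy refl by (auto simp: refl_on_def null_rel_def)
    from norm_dist_tendsto_cong[OF this yz] xy yz show "(x, z) \<in> null_rel p"
      by (auto simp: null_rel_def)
  qed
qed

lemma completion_dist_eqI:
  assumes "x \<in> cauchy_seqs p" "y \<in> cauchy_seqs p"
    and d: "(\<lambda>n. norm_dist p (x n) (y n)) \<longlonglongrightarrow> d"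
  shows "completion_dist p (null_rel p `` {x}) (null_rel p `` {y}) = d"
proof -
  have "x \<in> null_rel p `` {x}" "y \<in> null_rel p `` {y}"
    using equiv_class_self[OF equiv_null_rel] assms by auto
  then have "(THE d. \<forall>x'\<in>null_rel p `` {x}. \<forall>y'\<in>null_rel p `` {y}.
      (\<lambda>n. norm_dist p (x' n) (y' n)) \<longlonglongrightarrow> d) = d"
    by (intro the_equality) (auto intro: norm_dist_tendsto_cong[OF _ _ d] LIMSEQ_unique[OF _ d])
  moreover have "null_rel p `` {x} \<in> norm_completion p" "null_rel p `` {y} \<in> norm_completion p"
    using assms unfolding norm_completion_def by (auto intro: quotientI)
  ultimately show ?thesis by (simp add: completion_dist_def)
qed

lemma completion_dist_tendsto:
  assumes "x \<in> cauchy_seqs p" "y \<in> cauchy_seqs p"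
  shows "(\<lambda>n. norm_dist p (x n) (y n)) \<longlonglongrightarrow>
    completion_dist p (null_rel p `` {x}) (null_rel p `` {y})"
  using norm_dist_convergent[OF assms] completion_dist_eqI[OF assms] unfolding convergent_def
  by metis

lemma Metric_space_completion: "Metric_space (norm_completion p) (completion_dist p)"
proof
  fix X Y Z
  have rep: "\<exists>x. x \<in> cauchy_seqs p \<and> X = null_rel p `` {x}" if "X \<in> norm_completion p" for X
    using that unfolding norm_completion_def by (auto elim: quotientE)
  show "0 \<le> completion_dist p X Y"
  proof (cases "X \<in> norm_completion p \<and> Y \<in> norm_completion p")
    case True
    then obtain x y where "x \<in> cauchy_seqs p" "y \<in> cauchy_seqs p"
      "X = null_rel p `` {x}" "Y = null_rel p `` {y}" using rep by metis
    with completion_dist_tendsto[of x y] show ?thesis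
      by (auto intro: LIMSEQ_le_const simp: norm_dist_def norm_nonneg)
  qed (auto simp: completion_dist_def)
  show "completion_dist p X Y = completion_dist p Y X"
  proof (cases "X \<in> norm_completion p \<and> Y \<in> norm_completion p")
    case True
    then obtain x y where xy: "x \<in> cauchy_seqs p" "y \<in> cauchy_seqs p"
      "X = null_rel p `` {x}" "Y = null_rel p `` {y}" using rep by metis
    have "(\<lambda>n. norm_dist p (x n) (y n)) = (\<lambda>n. norm_dist p (y n) (x n))"
      by (simp add: norm_dist_def norm_diff_commute)
    with completion_dist_tendsto[OF xy(2,1)] xy completion_dist_eqI[OF xy(1,2)] show ?thesis
      by simp
  qed (auto simp: completion_dist_def)
  show "completion_dist p X Y = 0 \<longleftrightarrow> X = Y"
    if XY: "X \<in> norm_completion p" "Y \<in> norm_completion p"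
  proof -
    obtain x y where xy: "x \<in> cauchy_seqs p" "y \<in> cauchy_seqs p"
      "X = null_rel p `` {x}" "Y = null_rel p `` {y}" using rep XY by metis
    have "completion_dist p X Y = 0 \<longleftrightarrow> (\<lambda>n. norm_dist p (x n) (y n)) \<longlonglongrightarrow> 0"
      using completion_dist_tendsto[OF xy(1,2)] LIMSEQ_unique xy by metis
    also have "\<dots> \<longleftrightarrow> (x, y) \<in> null_rel p" using xy by (simp add: null_rel_def)
    also have "\<dots> \<longleftrightarrow> X = Y"
      using eq_equiv_class_iff[OF equiv_null_rel xy(1,2)] xy by simp
    finally show ?thesis .
  qed
  show "completion_dist p X Z \<le> completion_dist p X Y + completion_dist p Y Z"
    if XYZ: "X \<in> norm_completion p" "Y \<in> norm_completion p" "Z \<in> norm_completion p"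
  proof -
    obtain x y z where xyz: "x \<in> cauchy_seqs p" "y \<in> cauchy_seqs p" "z \<in> cauchy_seqs p"
      "X = null_rel p `` {x}" "Y = null_rel p `` {y}" "Z = null_rel p `` {z}"
      using rep XYZ by metis
    show ?thesis unfolding xyz(4-6)
      by (rule LIMSEQ_le[OF completion_dist_tendsto[OF xyz(1,3)]
            tendsto_add[OF completion_dist_tendsto[OF xyz(1,2)] completion_dist_tendsto[OF xyz(2,3)]]])
        (auto simp: norm_dist_def norm_diff_triangle)
  qed
qed

lemma class_in_unit_cball_iff:
  assumes "x \<in> cauchy_seqs p"
  shows "null_rel p `` {x} \<in> unit_cball p u \<longleftrightarrow> (\<exists>d\<le>1. (\<lambda>n. p (x n - u)) \<longlonglongrightarrow> d)"
proof -
  have mem: "null_rel p `` {x} \<in> norm_completion p" "completion_embed p u \<in> norm_completion p"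
    using assms const_in_cauchy_seqs unfolding norm_completion_def completion_embed_def
    by (auto intro: quotientI)
  have "(\<lambda>n. p (x n - u)) \<longlonglongrightarrow> completion_dist p (completion_embed p u) (null_rel p `` {x})"
    using completion_dist_tendsto[OF const_in_cauchy_seqs[of u] assms]
    by (simp add: norm_dist_def completion_embed_def norm_diff_commute)
  then have "completion_dist p (completion_embed p u) (null_rel p `` {x}) \<le> 1 \<longleftrightarrow>
      (\<exists>d\<le>1. (\<lambda>n. p (x n - u)) \<longlonglongrightarrow> d)"
    using LIMSEQ_unique by blast
  with mem show ?thesis
    unfolding unit_cball_def Metric_space.mcball_def[OF Metric_space_completion] by simp
qed

lemma meeting_triples_iff:
  "(u, v, w) \<in> meeting_triples p \<longleftrightarrow>
    (\<exists>x\<in>cauchy_seqs p. \<forall>y\<in>{u, v, w}. \<exists>d\<le>1. (\<lambda>n. p (x n - y)) \<longlonglongrightarrow> d)"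
proof -
  have "unit_cball p u \<subseteq> norm_completion p"
    unfolding unit_cball_def Metric_space.mcball_def[OF Metric_space_completion] by auto
  then have "(u, v, w) \<in> meeting_triples p \<longleftrightarrow>
      (\<exists>X\<in>norm_completion p. \<forall>y\<in>{u, v, w}. X \<in> unit_cball p y)"
    unfolding meeting_triples_def by auto
  also have "\<dots> \<longleftrightarrow> (\<exists>x\<in>cauchy_seqs p. \<forall>y\<in>{u, v, w}. null_rel p `` {x} \<in> unit_cball p y)"
    unfolding norm_completion_def quotient_def by auto
  finally show ?thesis by (simp add: class_in_unit_cball_iff cong: bex_cong)
qed

end

section \<open>A norm attached to a forest on the natural numbers\<close>

definition coord :: "qvec \<Rightarrow> nat \<Rightarrow> real" where
  "coord v i = of_rat (Poly_Mapping.lookup v i)"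

lemma coord_simps: "coord (u + v) = (\<lambda>i. coord u i + coord v i)"
  "coord (u - v) = (\<lambda>i. coord u i - coord v i)" "coord (- v) = (\<lambda>i. - coord v i)"
  "coord (scale c v) = (\<lambda>i. of_rat c * coord v i)" "coord 0 = (\<lambda>i. 0)"
  by (auto simp: fun_eq_iff coord_def lookup_add lookup_minus of_rat_add of_rat_diff of_rat_mult
    of_rat_minus scale_def Poly_Mapping.map.rep_eq when_def)

lemma coord_eq_0: "Poly_Mapping.degree v \<le> i \<Longrightarrow> coord v i = 0"
  by (simp add: coord_def beyond_degree_lookup_zero)

text \<open>
  Uniqueness of parents bounds the excess of a vector by a multiple of its \<open>\<ell>\<^sub>1\<close>-norm; \<open>s < j\<close> lets
  one cutoff serve for nodes and their parents, and makes the nodes of a path distinct.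
\<close>
locale forest =
  fixes child :: "nat \<Rightarrow> nat \<Rightarrow> bool"
  assumes child_less: "child s j \<Longrightarrow> s < j"
    and parent_unique: "child s j \<Longrightarrow> child t j \<Longrightarrow> s = t"
begin

text \<open>
  Vectors are read as functions with the coordinates \<open>a = x 0\<close> and \<open>b = x 1\<close>, and with \<open>x (s + 2)\<close> at
  the node \<open>s\<close>. The cutoff \<open>L\<close> only has to exceed the support; an explicit one lets the
  sums of several vectors range over the same set, and matches the computation from a code later on.
\<close>
definition outflow :: "nat \<Rightarrow> (nat \<Rightarrow> real) \<Rightarrow> nat \<Rightarrow> real" where
  "outflow L x s = (\<Sum>j<L. if child s j then x (j + 2) else 0)"

definition deficit :: "nat \<Rightarrow> (nat \<Rightarrow> real) \<Rightarrow> real" where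
  "deficit L x = (\<Sum>j<L. max 0 (- x (j + 2)))"

definition excess :: "nat \<Rightarrow> (nat \<Rightarrow> real) \<Rightarrow> real" where
  "excess L x = (\<Sum>s<L. max 0 (x (s + 2) - 2 * outflow L x s))"

definition gauge :: "nat \<Rightarrow> (nat \<Rightarrow> real) \<Rightarrow> real" where
  "gauge L x = max (deficit L x + x 0) (max (excess L x + x 1) (- x 0 - x 1))"

definition forest_norm :: "qvec \<Rightarrow> real" where
  "forest_norm v = max (gauge (Poly_Mapping.degree v) (coord v))
    (gauge (Poly_Mapping.degree v) (\<lambda>i. - coord v i))"

lemma gauge_cong:
  assumes "K \<le> L" "\<And>i. K \<le> i \<Longrightarrow> x i = 0"
  shows "gauge L x = gauge K x"
proof -
  have out: "outflow L x s = outflow K x s" for s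
    unfolding outflow_def using assms by (intro sum.mono_neutral_right) auto
  have "outflow K x s = 0" if "K \<le> s" for s
    unfolding outflow_def using that child_less[of s] by (intro sum.neutral) fastforce
  then have "excess L x = excess K x"
    unfolding excess_def out using assms by (intro sum.mono_neutral_right) auto
  moreover have "deficit L x = deficit K x"
    unfolding deficit_def using assms by (intro sum.mono_neutral_right) auto
  ultimately show ?thesis by (simp add: gauge_def)
qed

lemma forest_norm_eq:
  assumes "\<And>i. L \<le> i \<Longrightarrow> coord v i = 0"
  shows "forest_norm v = max (gauge L (coord v)) (gauge L (\<lambda>i. - coord v i))"
proof -
  have "gauge (max L (Poly_Mapping.degree v)) x = gauge L x"
    "gauge (max L (Poly_Mapping.degree v)) x = gauge (Poly_Mapping.degree v) x"
    if "x = coord v \<or> x = (\<lambda>i. - coord v i)" for x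
    using that assms by (auto intro!: gauge_cong simp: coord_eq_0)
  then show ?thesis by (metis forest_norm_def)
qed

lemma deficit_nonneg: "0 \<le> deficit L x" and excess_nonneg: "0 \<le> excess L x"
  by (auto simp: deficit_def excess_def intro: sum_nonneg)

text \<open>
  The three terms under the maximum have the nonnegative sum \<open>deficit + excess\<close>.
\<close>
lemma gauge_nonneg: "0 \<le> gauge L x"
  using deficit_nonneg[of L x] excess_nonneg[of L x] by (auto simp: gauge_def max_def)

lemma outflow_add: "outflow L (\<lambda>i. x i + y i) s = outflow L x s + outflow L y s"
  unfolding outflow_def sum.distrib[symmetric] by (intro sum.cong) auto

lemma outflow_mult: "outflow L (\<lambda>i. c * x i) s = c * outflow L x s"
  unfolding outflow_def sum_distrib_left by (intro sum.cong) auto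

lemma deficit_add: "deficit L (\<lambda>i. x i + y i) \<le> deficit L x + deficit L y"
  unfolding deficit_def sum.distrib[symmetric] by (intro sum_mono) auto

lemma excess_add: "excess L (\<lambda>i. x i + y i) \<le> excess L x + excess L y"
  unfolding excess_def outflow_add sum.distrib[symmetric] by (intro sum_mono) auto

lemma gauge_add: "gauge L (\<lambda>i. x i + y i) \<le> gauge L x + gauge L y"
  using deficit_add[of L x y] excess_add[of L x y] unfolding gauge_def by linarith

lemma max_0_mult: "0 \<le> c \<Longrightarrow> max 0 (c * a) = c * max 0 (a :: real)"
  by (simp add: max_mult_distrib_left)

lemma deficit_mult: "0 \<le> c \<Longrightarrow> deficit L (\<lambda>i. c * x i) = c * deficit L x"
  unfolding deficit_def sum_distrib_left by (intro sum.cong) (auto simp flip: max_0_mult)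

lemma excess_mult:
  assumes "0 \<le> c"
  shows "excess L (\<lambda>i. c * x i) = c * excess L x"
  unfolding excess_def sum_distrib_left outflow_mult max_0_mult[OF assms, symmetric]
  by (simp add: algebra_simps)

lemma gauge_mult: "0 \<le> c \<Longrightarrow> gauge L (\<lambda>i. c * x i) = c * gauge L x"
  by (simp add: gauge_def deficit_mult excess_mult max_mult_distrib_left algebra_simps)

text \<open>
  Adding the bounds for \<open>x\<close> and \<open>- x\<close> cancels \<open>a\<close> and \<open>b\<close>, so deficit and excess vanish in both directions.
\<close>
lemma gauge_nonpos_imp_0:
  assumes "gauge L x \<le> 0" "gauge L (\<lambda>i. - x i) \<le> 0" "i < L + 2"
  shows "x i = 0"
proof -
  have ge: "deficit L x + x 0 \<le> 0" "deficit L (\<lambda>i. - x i) - x 0 \<le> 0"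
    "excess L x + x 1 \<le> 0" "excess L (\<lambda>i. - x i) - x 1 \<le> 0"
    using assms(1,2) by (auto simp: gauge_def)
  then have 01: "x 0 = 0" "x 1 = 0"
    using deficit_nonneg[of L x] deficit_nonneg[of L "\<lambda>i. - x i"]
      excess_nonneg[of L x] excess_nonneg[of L "\<lambda>i. - x i"] by linarith+
  have nonneg: "x (j + 2) \<ge> 0" if "deficit L x \<le> 0" "j < L" for j x
  proof -
    have "max 0 (- x (j + 2)) \<le> deficit L x"
      unfolding deficit_def using that(2) by (intro member_le_sum) auto
    with that(1) show ?thesis by simp
  qed
  show ?thesis
  proof (cases "i < 2")
    case True
    with 01 show ?thesis by (auto simp: less_2_cases_iff)
  next
    case False
    then obtain j where "i = j + 2" "j < L" using assms(3) by (metis add.commute le_Suc_ex nat_add_left_cancel_less not_less)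
    then show ?thesis using nonneg[of x j] nonneg[of "\<lambda>i. - x i" j] ge 01 by simp
  qed
qed

lemma is_norm_forest_norm: "is_norm forest_norm"
  unfolding is_norm_def
proof (intro conjI allI)
  fix u v :: qvec and c :: rat
  let ?L = "Poly_Mapping.degree v"
  show nonneg: "0 \<le> forest_norm v" using gauge_nonneg by (auto simp: forest_norm_def le_max_iff_disj)
  show "forest_norm v = 0 \<longleftrightarrow> v = 0"
  proof
    assume "forest_norm v = 0"
    then have "gauge ?L (coord v) \<le> 0" "gauge ?L (\<lambda>i. - coord v i) \<le> 0"
      by (auto simp: forest_norm_def)
    then have "coord v i = 0" if "i < ?L + 2" for i
      using gauge_nonpos_imp_0 that by blast
    then have "coord v i = 0" for i
      using coord_eq_0[of v i] by (cases "i < ?L") auto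
    then show "v = 0" by (auto simp: coord_def intro: poly_mapping_eqI)
  qed (simp add: forest_norm_def coord_simps gauge_def deficit_def excess_def)
  show "forest_norm (scale c v) = \<bar>of_rat c\<bar> * forest_norm v"
  proof -
    have *: "forest_norm (scale c v) = max (gauge ?L (\<lambda>i. of_rat c * coord v i))
        (gauge ?L (\<lambda>i. - (of_rat c * coord v i)))"
      using forest_norm_eq[of ?L "scale c v"] by (simp add: coord_simps coord_eq_0)
    show ?thesis
    proof (cases "0 \<le> c")
      case True
      have "(\<lambda>i. - (of_rat c * coord v i)) = (\<lambda>i. of_rat c * (- coord v i))" by simp
      then show ?thesis unfolding * using True
        by (simp only: gauge_mult zero_le_of_rat_iff) (simp add: forest_norm_def max_mult_distrib_left)
    next
      case False
      then have neg: "0 \<le> - (of_rat c :: real)" by (simp add: of_rat_less_0_iff less_imp_le)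
      have "(\<lambda>i. of_rat c * coord v i) = (\<lambda>i. - of_rat c * (- coord v i))"
        "(\<lambda>i. - (of_rat c * coord v i)) = (\<lambda>i. - of_rat c * coord v i)" by simp_all
      then have "forest_norm (scale c v) =
          - of_rat c * max (gauge ?L (\<lambda>i. - coord v i)) (gauge ?L (coord v))"
        unfolding * using gauge_mult[OF neg, of ?L] neg by (simp only: max_mult_distrib_left if_True)
      moreover have "\<bar>of_rat c\<bar> = - (of_rat c :: real)" using neg by (simp only: abs_of_nonpos neg_0_le_iff_le)
      ultimately show ?thesis by (simp only: forest_norm_def[of v] max.commute)
    qed
  qed
  show "forest_norm (u + v) \<le> forest_norm u + forest_norm v"
  proof -
    define L where "L = max (Poly_Mapping.degree u) (Poly_Mapping.degree v)"
    have z: "coord u i = 0" "coord v i = 0" if "L \<le> i" for i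
      using that by (auto simp: L_def coord_eq_0)
    have "(\<lambda>i. - coord (u + v) i) = (\<lambda>i. - coord u i + - coord v i)" by (simp add: coord_simps)
    moreover have "forest_norm (u + v) = max (gauge L (coord (u + v))) (gauge L (\<lambda>i. - coord (u + v) i))"
      by (rule forest_norm_eq) (simp add: coord_simps z)
    moreover have "forest_norm u = max (gauge L (coord u)) (gauge L (\<lambda>i. - coord u i))"
      "forest_norm v = max (gauge L (coord v)) (gauge L (\<lambda>i. - coord v i))"
      using z by (auto intro: forest_norm_eq)
    ultimately show ?thesis
      using gauge_add[of L "coord u" "coord v"]
        gauge_add[of L "\<lambda>i. - coord u i" "\<lambda>i. - coord v i"]
      unfolding coord_simps(1) by (simp only:)
  qed
qed

lemma outflow_cong:
  assumes "K \<le> L" "\<And>i. K \<le> i \<Longrightarrow> x i = 0"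
  shows "outflow L x s = outflow K x s"
  unfolding outflow_def using assms by (intro sum.mono_neutral_right) auto

lemma forest_norm_minus: "forest_norm (- v) = forest_norm v"
  using norm_minus[OF is_norm_forest_norm] .

lemma gauge_ge:
  "deficit L x + x 0 \<le> gauge L x" "excess L x + x 1 \<le> gauge L x" "- x 0 - x 1 \<le> gauge L x"
  by (auto simp: gauge_def)

lemma gauge_le_forest_norm:
  assumes "\<And>i. L \<le> i \<Longrightarrow> coord v i = 0"
  shows "gauge L (coord v) \<le> forest_norm v"
  by (subst forest_norm_eq[of L v, OF assms]) auto

lemma plane_coord_le:
  "\<bar>coord v 0\<bar> \<le> forest_norm v" "\<bar>coord v 1\<bar> \<le> forest_norm v"
  "- coord v 0 - coord v 1 \<le> forest_norm v"
proof -
  have le: "coord v 0 \<le> forest_norm v" "coord v 1 \<le> forest_norm v"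
    "- coord v 0 - coord v 1 \<le> forest_norm v" for v
    using gauge_le_forest_norm[of "Poly_Mapping.degree v" v, OF coord_eq_0]
      gauge_ge[where L = "Poly_Mapping.degree v" and x = "coord v"]
      deficit_nonneg[of "Poly_Mapping.degree v" "coord v"]
      excess_nonneg[of "Poly_Mapping.degree v" "coord v"]
    by linarith+
  show "\<bar>coord v 0\<bar> \<le> forest_norm v" "\<bar>coord v 1\<bar> \<le> forest_norm v"
    using le(1,2)[of v] le(1,2)[of "- v"] by (auto simp: abs_le_iff forest_norm_minus coord_simps)
  show "- coord v 0 - coord v 1 \<le> forest_norm v" by (rule le)
qed

lemma deficit_le:
  assumes "\<And>i. L \<le> i \<Longrightarrow> coord v i = 0"
  shows "deficit L (coord v) + coord v 0 \<le> forest_norm v"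
  using gauge_ge(1) gauge_le_forest_norm[OF assms] by (rule order_trans)

lemma negative_coord_le: "coord v 0 - coord v (j + 2) \<le> forest_norm v"
proof -
  let ?L = "max (Poly_Mapping.degree v) (Suc j)"
  have "max 0 (- coord v (j + 2)) \<le> deficit ?L (coord v)"
    unfolding deficit_def by (intro member_le_sum) auto
  moreover have "deficit ?L (coord v) + coord v 0 \<le> forest_norm v"
    by (intro deficit_le) (simp add: coord_eq_0)
  ultimately show ?thesis by linarith
qed

lemma coord_le: "\<bar>coord v i\<bar> \<le> 2 * forest_norm v"
proof (cases "i < 2")
  case True
  then show ?thesis
    using plane_coord_le(1,2)[of v] by (auto simp: less_2_cases_iff)
next
  case False
  then obtain j where i: "i = j + 2" by (metis add.commute le_Suc_ex not_less)
  show ?thesis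
    using negative_coord_le[of v j] negative_coord_le[of "- v" j] plane_coord_le(1)[of v]
    unfolding i forest_norm_minus coord_simps by linarith
qed

text \<open>
  The norm dominates half the \<open>\<ell>\<^sub>1\<close>-norm of the forest part: the sum of absolute values is the deficit of the
  vector plus that of its negative, and the contributions of \<open>a\<close> cancel.
\<close>
lemma sum_abs_coord_le:
  assumes L: "\<And>i. L \<le> i \<Longrightarrow> coord v i = 0"
  shows "(\<Sum>j<L. \<bar>coord v (j + 2)\<bar>) \<le> 2 * forest_norm v"
proof -
  have "(\<Sum>j<L. \<bar>coord v (j + 2)\<bar>) = deficit L (coord v) + deficit L (coord (- v))"
    unfolding deficit_def coord_simps sum.distrib[symmetric] by (intro sum.cong) auto
  moreover have "deficit L (coord v) + coord v 0 \<le> forest_norm v"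
    using L by (rule deficit_le)
  moreover have "deficit L (coord (- v)) + coord (- v) 0 \<le> forest_norm (- v)"
    using L by (intro deficit_le) (simp add: coord_simps)
  ultimately show ?thesis by (simp add: forest_norm_minus coord_simps)
qed

lemma excess_le:
  assumes L: "\<And>i. L \<le> i \<Longrightarrow> coord v i = 0"
  shows "coord v 1 + (coord v (s + 2) - 2 * outflow L (coord v) s) \<le> forest_norm v"
proof -
  let ?L = "max L (Suc s)"
  have "max 0 (coord v (s + 2) - 2 * outflow ?L (coord v) s) \<le> excess ?L (coord v)"
    unfolding excess_def by (intro member_le_sum) auto
  moreover have "excess ?L (coord v) + coord v 1 \<le> forest_norm v"
    using gauge_ge(2) by (rule order_trans) (use L in \<open>auto intro: gauge_le_forest_norm\<close>)
  moreover have "outflow ?L (coord v) s = outflow L (coord v) s"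
    using L by (intro outflow_cong) auto
  ultimately show ?thesis by linarith
qed

text \<open>
  A common point of the balls is a Cauchy sequence, and its coordinates converge to some \<open>z\<close>. The
  constraints pass to the limit and say that \<open>z\<close> is positive at \<open>r\<close> and that a node at which \<open>z\<close> is
  positive has such a child, so a path is found by dependent choice. The outflow in the excess
  constraint ranges over infinitely many children; it is controlled because the sequence is
  Cauchy in \<open>\<ell>\<^sub>1\<close>, so that beyond the support of one late member the tails are uniformly small.
\<close>
lemma path_if_meeting:
  assumes meet: "(u, v, w) \<in> meeting_triples forest_norm"
    and u: "coord u = (\<lambda>i. if i = 0 then - 1 else if i = 1 then 1 / 2 else if i = r + 2 then 1 / 8 else 0)"
    and v: "coord v = (\<lambda>i. if i = 0 then 1 / 2 else if i = 1 then - 1 else 0)"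
    and w: "coord w = (\<lambda>i. if i = 0 then 1 / 2 else if i = 1 then 1 / 2 else 0)"
  shows "\<exists>j. j 0 = r \<and> (\<forall>k. child (j k) (j (Suc k)))"
proof -
  let ?p = forest_norm
  note norm = is_norm_forest_norm
  obtain x d1 d2 d3 where x: "x \<in> cauchy_seqs ?p"
    and d: "d1 \<le> 1" "(\<lambda>n. ?p (x n - u)) \<longlonglongrightarrow> d1" "d2 \<le> 1" "(\<lambda>n. ?p (x n - v)) \<longlonglongrightarrow> d2"
      "d3 \<le> 1" "(\<lambda>n. ?p (x n - w)) \<longlonglongrightarrow> d3"
    using meet unfolding meeting_triples_iff[OF norm] by auto
  have "convergent (\<lambda>n. coord (x n) i)" for i
  proof -
    have "Cauchy (\<lambda>n. coord (x n) i)"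
    proof (rule metric_CauchyI)
      fix \<epsilon> :: real assume "0 < \<epsilon>"
      then obtain N where "\<forall>n\<ge>N. \<forall>m\<ge>N. ?p (x n - x m) < \<epsilon> / 2"
        using x unfolding cauchy_seqs_iff[OF norm] by (meson half_gt_zero)
      then have "dist (coord (x n) i) (coord (x m) i) < \<epsilon>" if "n \<ge> N" "m \<ge> N" for n m
        using coord_le[of "x n - x m" i] that by (fastforce simp: dist_real_def coord_simps)
      then show "\<exists>N. \<forall>n\<ge>N. \<forall>m\<ge>N. dist (coord (x n) i) (coord (x m) i) < \<epsilon>" by blast
    qed
    then show ?thesis by (simp add: Cauchy_convergent_iff)
  qed
  then obtain z where z: "\<And>i. (\<lambda>n. coord (x n) i) \<longlonglongrightarrow> z i"
    unfolding convergent_def by metis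
  have "z 0 - (- 1) \<le> d1"
    by (rule LIMSEQ_le[OF tendsto_diff[OF z tendsto_const] d(2)])
      (use plane_coord_le(1)[of "x _ - u"] in \<open>auto simp: coord_simps u abs_le_iff\<close>)
  moreover have "z 1 - (- 1) \<le> d2"
    by (rule LIMSEQ_le[OF tendsto_diff[OF z tendsto_const] d(4)])
      (use plane_coord_le(2)[of "x _ - v"] in \<open>auto simp: coord_simps v abs_le_iff\<close>)
  moreover have "1 - z 0 - z 1 \<le> d3"
    by (rule LIMSEQ_le[OF tendsto_diff[OF tendsto_diff[OF tendsto_const z] z] d(6)])
      (use plane_coord_le(3)[of "x _ - w"] in \<open>auto simp: coord_simps w algebra_simps\<close>)
  \<comment> \<open>Each of the three balls bounds one of the forms \<open>a\<close>, \<open>b\<close>, \<open>- a - b\<close> by 0, and the forms add up to 0.\<close>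
  ultimately have z01: "z 0 = 0" "z 1 = 0" using d(1,3,5) by linarith+
  have z_ge: "(if j = r then 1 / 8 else 0) \<le> z (j + 2)" for j
  proof -
    have "z 0 - (- 1) - (z (j + 2) - (if j = r then 1 / 8 else 0)) \<le> d1"
      by (rule LIMSEQ_le[OF tendsto_diff[OF tendsto_diff[OF z tendsto_const]
            tendsto_diff[OF z tendsto_const]] d(2)])
        (use negative_coord_le[of "x _ - u" j] in \<open>auto simp: coord_simps u\<close>)
    then show ?thesis using z01 d(1) by linarith
  qed
  have step: "\<exists>j. child s j \<and> 0 < z (j + 2)" if s: "0 < z (s + 2)" for s
  proof (rule ccontr)
    assume no: "\<not> ?thesis"
    \<comment> \<open>The tail of the outflow is at most \<open>2 * \<epsilon>\<close> and enters twice, so any divisor above 4 works.\<close>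
    define \<epsilon> where "\<epsilon> = z (s + 2) / 8"
    have "0 < \<epsilon>" using s by (simp add: \<epsilon>_def)
    then obtain M where M: "\<And>n. n \<ge> M \<Longrightarrow> ?p (x n - x M) < \<epsilon>"
      using x unfolding cauchy_seqs_iff[OF norm] by blast
    define K where "K = Poly_Mapping.degree (x M)"
    have bound: "coord (x n) (s + 2) \<le> ?p (x n - v) - 1 - coord (x n) 1 + 2 * outflow K (coord (x n)) s + 4 * \<epsilon>"
      if n: "n \<ge> M" for n
    proof -
      define L where "L = max 2 (max K (Poly_Mapping.degree (x n)))"
      have L: "coord (x n - v) i = 0" "coord (x n - x M) i = 0" if "L \<le> i" for i
        using that by (auto simp: coord_simps v coord_eq_0 L_def K_def)
      have "outflow L (coord (x n - v)) s = outflow L (coord (x n)) s"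
        unfolding outflow_def coord_simps v by (intro sum.cong) auto
      moreover have "outflow L (coord (x n)) s \<le> outflow K (coord (x n)) s + 2 * \<epsilon>"
      proof -
        let ?f = "\<lambda>j. if child s j then coord (x n) (j + 2) else 0"
        have "{..<L} = {..<K} \<union> {K..<L}" "{..<K} \<inter> {K..<L} = {}" by (auto simp: L_def)
        then have "outflow L (coord (x n)) s = outflow K (coord (x n)) s + sum ?f {K..<L}"
          unfolding outflow_def by (simp add: sum.union_disjoint)
        also have "sum ?f {K..<L} \<le> (\<Sum>j\<in>{K..<L}. \<bar>coord (x n - x M) (j + 2)\<bar>)"
          by (intro sum_mono) (auto simp: coord_simps coord_eq_0 K_def)
        also have "\<dots> \<le> (\<Sum>j<L. \<bar>coord (x n - x M) (j + 2)\<bar>)"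
          by (intro sum_mono2) auto
        also have "\<dots> \<le> 2 * ?p (x n - x M)" using L(2) by (rule sum_abs_coord_le)
        also have "\<dots> \<le> 2 * \<epsilon>" using M[OF n] by simp
        finally show ?thesis by simp
      qed
      moreover have "coord (x n - v) 1 + (coord (x n - v) (s + 2) -
          2 * outflow L (coord (x n - v)) s) \<le> ?p (x n - v)"
        using L(1) by (rule excess_le)
      ultimately show ?thesis by (simp add: coord_simps v)
    qed
    have lim: "(\<lambda>n. outflow K (coord (x n)) s) \<longlonglongrightarrow> outflow K z s"
      unfolding outflow_def by (intro tendsto_sum) (auto intro: z)
    have "z (s + 2) \<le> d2 - 1 - z 1 + 2 * outflow K z s + 4 * \<epsilon>"
      by (rule LIMSEQ_le[OF z tendsto_add[OF tendsto_add[OF tendsto_diff[OF tendsto_diff[OF d(4)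
            tendsto_const] z] tendsto_mult[OF tendsto_const lim]] tendsto_const]])
        (use bound in auto)
    moreover have "outflow K z s \<le> 0"
      unfolding outflow_def using no by (intro sum_nonpos) (auto simp: not_less)
    ultimately have "z (s + 2) \<le> 4 * \<epsilon>" using d(3) z01 by linarith
    then show False using s by (simp add: \<epsilon>_def)
  qed
  have "0 < z (r + 2)" using z_ge[of r] by simp
  with step obtain j where "j 0 = r" "\<And>k. 0 < z (j k + 2) \<and> child (j k) (j (Suc k))"
    using dependent_nat_choice[of "\<lambda>n s. 0 < z (s + 2) \<and> (n = 0 \<longrightarrow> s = r)" "\<lambda>n s t. child s t"] by auto
  then show ?thesis by blast
qed

lemma deficit_excess_cong:
  assumes "\<And>i. 2 \<le> i \<Longrightarrow> x i = y i"
  shows "deficit L x = deficit L y" "excess L x = excess L y"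
proof -
  have "x (i + 2) = y (i + 2)" for i using assms by simp
  then show "deficit L x = deficit L y" "excess L x = excess L y"
    by (simp_all only: deficit_def excess_def outflow_def)
qed

lemma deficit_sum_le:
  assumes "finite A"
  shows "deficit L (\<lambda>i. \<Sum>k\<in>A. f k i) \<le> (\<Sum>k\<in>A. deficit L (f k))"
  using assms
proof (induction A rule: finite_induct)
  case (insert a A)
  then show ?case using deficit_add[of L "f a" "\<lambda>i. \<Sum>k\<in>A. f k i"] by simp
qed (simp add: deficit_def)

lemma excess_sum_le:
  assumes "finite A"
  shows "excess L (\<lambda>i. \<Sum>k\<in>A. f k i) \<le> (\<Sum>k\<in>A. excess L (f k))"
  using assms
proof (induction A rule: finite_induct)
  case (insert a A)
  then show ?case using excess_add[of L "f a" "\<lambda>i. \<Sum>k\<in>A. f k i"] by simp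
qed (simp add: excess_def outflow_def)

lemma deficit_single_le: "deficit L (\<lambda>i. if i = j + 2 then c else 0) \<le> \<bar>c\<bar>"
proof -
  have "deficit L (\<lambda>i. if i = j + 2 then c else 0) \<le> (\<Sum>i<L. if i = j then \<bar>c\<bar> else 0)"
    unfolding deficit_def by (intro sum_mono) auto
  then show ?thesis by (simp split: if_splits)
qed

text \<open>
  A positive entry at \<open>j\<close> contributes only at the node \<open>j\<close> itself, and a negative one only at its
  parent, where it counts twice.
\<close>
lemma excess_single_le: "excess L (\<lambda>i. if i = j + 2 then c else 0) \<le> 2 * \<bar>c\<bar>"
proof -
  define t where "t = (if 0 \<le> c then j else THE s. child s j)"
  have out: "outflow L (\<lambda>i. if i = j + 2 then c else 0) s = (if child s j \<and> j < L then c else 0)" for s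
  proof -
    have "outflow L (\<lambda>i. if i = j + 2 then c else 0) s = (\<Sum>i<L. if i = j then if child s j then c else 0 else 0)"
      unfolding outflow_def by (intro sum.cong) auto
    then show ?thesis by simp
  qed
  have "t = s" if "c < 0" "child s j" for s
    using that parent_unique by (auto simp: t_def intro!: the_equality)
  moreover have "t = j" if "0 \<le> c" using that by (simp add: t_def)
  moreover have "\<not> child j j" using child_less[of j j] by blast
  ultimately have summand: "max 0 ((if s + 2 = j + 2 then c else 0) - 2 * (if child s j \<and> j < L then c else 0))
      \<le> (if s = t then 2 * \<bar>c\<bar> else 0)" for s
    by (cases "0 \<le> c"; cases "s = j"; cases "child s j") auto
  have "excess L (\<lambda>i. if i = j + 2 then c else 0) \<le> (\<Sum>s<L. if s = t then 2 * \<bar>c\<bar> else 0)"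
    unfolding excess_def out by (intro sum_mono summand)
  then show ?thesis by (simp split: if_splits)
qed

text \<open>
  Deficit and excess are subadditive, so that bounds for unit vectors suffice.
\<close>
lemma combination_bounds:
  fixes j :: "nat \<Rightarrow> nat" and \<delta> :: "nat \<Rightarrow> real"
  assumes "finite A" "\<And>k. k \<in> A \<Longrightarrow> 0 \<le> \<delta> k"
  defines "y \<equiv> \<lambda>i. \<Sum>k\<in>A. if i = j k + 2 then \<delta> k else 0"
  shows "deficit L y = 0" "deficit L (\<lambda>i. - y i) \<le> sum \<delta> A"
    "excess L y \<le> 2 * sum \<delta> A" "excess L (\<lambda>i. - y i) \<le> 2 * sum \<delta> A"
proof -
  have neg: "(\<lambda>i. - y i) = (\<lambda>i. \<Sum>k\<in>A. if i = j k + 2 then - \<delta> k else 0)"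
    unfolding y_def sum_negf[symmetric] by (intro ext sum.cong) auto
  have "0 \<le> y i" for i unfolding y_def using assms(1,2) by (intro sum_nonneg) auto
  then show "deficit L y = 0" by (simp add: deficit_def)
  have "deficit L (\<lambda>i. - y i) \<le> (\<Sum>k\<in>A. deficit L (\<lambda>i. if i = j k + 2 then - \<delta> k else 0))"
    unfolding neg using assms(1) by (rule deficit_sum_le)
  also have "\<dots> \<le> sum \<delta> A"
  proof (rule sum_mono)
    show "deficit L (\<lambda>i. if i = j k + 2 then - \<delta> k else 0) \<le> \<delta> k" if "k \<in> A" for k
      using deficit_single_le[of L "j k" "- \<delta> k"] assms(2)[OF that]
      by (simp only: abs_minus_cancel abs_of_nonneg)
  qed
  finally show "deficit L (\<lambda>i. - y i) \<le> sum \<delta> A" .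
  have "excess L y \<le> (\<Sum>k\<in>A. excess L (\<lambda>i. if i = j k + 2 then \<delta> k else 0))"
    unfolding y_def using assms(1) by (rule excess_sum_le)
  also have "\<dots> \<le> (\<Sum>k\<in>A. 2 * \<delta> k)"
  proof (rule sum_mono)
    show "excess L (\<lambda>i. if i = j k + 2 then \<delta> k else 0) \<le> 2 * \<delta> k" if "k \<in> A" for k
      using excess_single_le[of L "j k" "\<delta> k"] assms(2)[OF that]
      by (simp only: abs_minus_cancel abs_of_nonneg)
  qed
  finally show "excess L y \<le> 2 * sum \<delta> A" by (simp add: sum_distrib_left)
  have "excess L (\<lambda>i. - y i) \<le> (\<Sum>k\<in>A. excess L (\<lambda>i. if i = j k + 2 then - \<delta> k else 0))"
    unfolding neg using assms(1) by (rule excess_sum_le)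
  also have "\<dots> \<le> (\<Sum>k\<in>A. 2 * \<delta> k)"
  proof (rule sum_mono)
    show "excess L (\<lambda>i. if i = j k + 2 then - \<delta> k else 0) \<le> 2 * \<delta> k" if "k \<in> A" for k
      using excess_single_le[of L "j k" "- \<delta> k"] assms(2)[OF that]
      by (simp only: abs_minus_cancel abs_of_nonneg)
  qed
  finally show "excess L (\<lambda>i. - y i) \<le> 2 * sum \<delta> A" by (simp add: sum_distrib_left)
qed

text \<open>
  The common point is the limit of \<open>x m = (\<Sum>k\<le>m. e (j k) / (8 * 2^k))\<close>, with unit vectors \<open>e s\<close>. At every node of the
  path except the last one the excess vanishes, because the next weight is half the current one, so the
  excess of \<open>x m\<close> is at most \<open>1 / (8 * 2^m)\<close>. The first weight \<open>1/8\<close> makes the weights sum to less than \<open>1/4\<close>,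
  so that all other deficits and excesses are at most \<open>1/2\<close>, for which the centres leave room.
\<close>
lemma meeting_if_path:
  assumes j0: "j 0 = r" and path: "\<And>k. child (j k) (j (Suc k))"
    and u: "coord u = (\<lambda>i. if i = 0 then - 1 else if i = 1 then 1 / 2 else if i = r + 2 then 1 / 8 else 0)"
    and v: "coord v = (\<lambda>i. if i = 0 then 1 / 2 else if i = 1 then - 1 else 0)"
    and w: "coord w = (\<lambda>i. if i = 0 then 1 / 2 else if i = 1 then 1 / 2 else 0)"
  shows "(u, v, w) \<in> meeting_triples forest_norm"
proof -
  let ?p = forest_norm
  note norm = is_norm_forest_norm
  define \<delta> :: "nat \<Rightarrow> real" where "\<delta> k = (1 / 2) ^ k / 8" for k
  define y where "y A i = (\<Sum>k\<in>A. if i = j k + 2 then \<delta> k else 0)" for A i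
  define x where "x m = (\<Sum>k\<le>m. Poly_Mapping.single (j k + 2) ((1 / 2) ^ k / 8 :: rat))" for m
  have \<delta>_nonneg: "0 \<le> \<delta> k" for k by (simp add: \<delta>_def)
  have mono: "strict_mono j"
    unfolding strict_mono_Suc_iff using path child_less by blast
  have j_eq: "j k = j l \<longleftrightarrow> k = l" and j_le: "k \<le> l \<Longrightarrow> j k \<le> j l" for k l
    using mono by (simp_all add: strict_mono_eq strict_mono_less_eq)
  have coord_x: "coord (x m) = y {..m}" for m
    unfolding x_def y_def coord_def fun_eq_iff lookup_sum of_rat_sum \<delta>_def
    by (intro allI sum.cong)
      (auto simp: lookup_single when_def of_rat_divide of_rat_power)
  have geo: "sum \<delta> {m..<n} \<le> 2 * \<delta> m" for m n
  proof -
    have "m \<le> n \<Longrightarrow> sum \<delta> {m..<n} = 2 * \<delta> m - 2 * \<delta> n"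
    proof (induction n rule: dec_induct)
      case (step n)
      then show ?case by (simp add: \<delta>_def)
    qed simp
    then show ?thesis using \<delta>_nonneg[of n] \<delta>_nonneg[of m] by (cases "m \<le> n") auto
  qed
  have y_bounds: "deficit L (y A) = 0" "deficit L (\<lambda>i. - y A i) \<le> 1 / 4"
    "excess L (y A) \<le> 1 / 2" "excess L (\<lambda>i. - y A i) \<le> 1 / 2" if A: "A \<subseteq> {0..<n}" for A n L
  proof -
    have "sum \<delta> A \<le> sum \<delta> {0..<n}" using A \<delta>_nonneg by (intro sum_mono2) auto
    then have s: "sum \<delta> A \<le> 1 / 4" using geo[of 0 n] by (simp add: \<delta>_def)
    have "finite A" using A finite_subset by blast
    note b = combination_bounds[OF this, where \<delta> = \<delta> and j = j and L = L, folded y_def, OF \<delta>_nonneg]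
    show "deficit L (y A) = 0" "deficit L (\<lambda>i. - y A i) \<le> 1 / 4"
      "excess L (y A) \<le> 1 / 2" "excess L (\<lambda>i. - y A i) \<le> 1 / 2"
      using b s by linarith+
  qed
  have y01: "y A 0 = 0" "y A 1 = 0" "y A (Suc 0) = 0" for A by (simp_all add: y_def)
  have coord_v_le: "?p (x n - x m) \<le> 4 * \<delta> (Suc m)" if mn: "m \<le> n" for m n
  proof -
    define A where "A = {Suc m..<Suc n}"
    have "{..n} = {..m} \<union> A" "{..m} \<inter> A = {}" using mn by (auto simp: A_def)
    then have "y {..n} i = y {..m} i + y A i" for i
      unfolding y_def by (simp add: sum.union_disjoint A_def)
    then have c: "coord (x n - x m) = y A" by (auto simp: coord_simps coord_x)
    have "finite A" by (simp add: A_def)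
    note b = combination_bounds[OF this, where \<delta> = \<delta> and j = j and
        L = "Poly_Mapping.degree (x n - x m)", folded y_def, OF \<delta>_nonneg]
    have "sum \<delta> A \<le> 2 * \<delta> (Suc m)" unfolding A_def by (rule geo)
    then show ?thesis
      using b y01[of A] \<delta>_nonneg sum_nonneg[of A \<delta>] unfolding forest_norm_def c gauge_def by simp
  qed
  have \<delta>_lim: "\<delta> \<longlonglongrightarrow> 0"
    unfolding \<delta>_def by (auto intro!: tendsto_eq_intros LIMSEQ_power_zero)
  have x: "x \<in> cauchy_seqs ?p"
    unfolding cauchy_seqs_iff[OF norm]
  proof (intro allI impI)
    fix \<epsilon> :: real assume "0 < \<epsilon>"
    then obtain N where "\<delta> N < \<epsilon> / 2"
      using order_tendstoD(2)[OF \<delta>_lim, of "\<epsilon> / 2"] by (auto simp: eventually_sequentially)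
    then have N: "2 * \<delta> N < \<epsilon>" by simp
    have "\<delta> (Suc m) \<le> \<delta> N / 2" if "m \<ge> N" for m
      using that power_decreasing[of N m "1 / 2 :: real"] by (simp add: \<delta>_def)
    then have less: "?p (x n - x m) < \<epsilon>" if "m \<le> n" "m \<ge> N" for n m
      using coord_v_le[of m n] N that by fastforce
    have "?p (x n - x m) < \<epsilon>" if "m \<ge> N" "n \<ge> N" for n m
    proof (cases "m \<le> n")
      case True
      then show ?thesis using that by (intro less)
    next
      case False
      then have "?p (x m - x n) < \<epsilon>" using that by (intro less) auto
      then show ?thesis by (subst norm_diff_commute[OF norm])
    qed
    then show "\<exists>N. \<forall>n\<ge>N. \<forall>m\<ge>N. ?p (x n - x m) < \<epsilon>" by blast
  qed
  have excess_x: "excess L (y {..m}) \<le> \<delta> m" if L: "j m < L" for L m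
  proof -
    have y_j: "y {..m} (j k + 2) = (if k \<le> m then \<delta> k else 0)" for k
      by (simp add: y_def j_eq sum.delta)
    have y_nonneg: "0 \<le> y {..m} i" for i
      unfolding y_def using \<delta>_nonneg by (intro sum_nonneg) auto
    have out_nonneg: "0 \<le> outflow L (y {..m}) s" for s
      unfolding outflow_def using y_nonneg by (intro sum_nonneg) auto
    have "max 0 (y {..m} (s + 2) - 2 * outflow L (y {..m}) s) \<le> (if s = j m then \<delta> m else 0)" for s
    proof (cases "\<exists>k<m. s = j k")
      case True
      then obtain k where k: "k < m" "s = j k" by blast
      have "(if child s (j (Suc k)) then y {..m} (j (Suc k) + 2) else 0) \<le> outflow L (y {..m}) s"
        unfolding outflow_def using y_nonneg L j_le[of "Suc k" m] k
        by (intro member_le_sum) auto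
      then have "\<delta> (Suc k) \<le> outflow L (y {..m}) s"
        using path[of k] k y_j[of "Suc k"] by auto
      then show ?thesis using k y_j[of k] \<delta>_nonneg[of m] by (simp add: \<delta>_def)
    next
      case False
      show ?thesis
      proof (cases "s = j m")
        case True
        then show ?thesis using y_j[of m] out_nonneg[of s] \<delta>_nonneg[of m] by simp
      next
        case ne: False
        have "y {..m} (s + 2) = 0"
          unfolding y_def using False ne by (intro sum.neutral) (auto simp: le_less)
        then show ?thesis using ne out_nonneg[of s] by simp
      qed
    qed
    then have "excess L (y {..m}) \<le> (\<Sum>s<L. if s = j m then \<delta> m else 0)"
      unfolding excess_def by (intro sum_mono)
    then show ?thesis using L by simp
  qed
  have ball: "?p (x m - c) \<le> 1 + \<delta> m" if c: "c \<in> {u, v, w}" for m c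
  proof -
    define L where "L = j m + 3"
    have y0: "y {..m} i = 0" if "L \<le> i" for i
      unfolding y_def using that j_le[of _ m] by (intro sum.neutral) (force simp: L_def)
    have rL: "r < j m + 1" using j_le[of 0 m] by (simp add: j0)
    have "coord (x m - c) i = 0" if "L \<le> i" for i
      using that c rL by (auto simp: coord_simps coord_x y0 u v w L_def)
    then have p: "?p (x m - c) = max (gauge L (coord (x m - c))) (gauge L (\<lambda>i. - coord (x m - c) i))"
      by (rule forest_norm_eq)
    \<comment> \<open>Subtracting the centre \<open>u\<close> removes exactly the first weight, the one at the root.\<close>
    define A where "A = (if c = u then {1..m} else {..m})"
    have shift: "y {..m} i - (if i = r + 2 then 1 / 8 else 0) = y {1..m} i" for i
    proof -
      have "{..m} = insert 0 {1..m}" by auto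
      then show ?thesis by (simp add: y_def j0 \<delta>_def)
    qed
    then have A: "coord (x m - c) i = y A i" if "2 \<le> i" for i
    proof -
      have "coord u i = (if i = r + 2 then 1 / 8 else 0)" "coord v i = 0" "coord w i = 0"
        using that by (simp_all add: u v w)
      then show ?thesis
        using c shift[of i] by (auto simp: coord_simps coord_x A_def)
    qed
    have sub: "A \<subseteq> {0..<Suc m}" by (auto simp: A_def)
    have eq: "deficit L (coord (x m - c)) = deficit L (y A)"
      "deficit L (\<lambda>i. - coord (x m - c) i) = deficit L (\<lambda>i. - y A i)"
      "excess L (coord (x m - c)) = excess L (y A)"
      "excess L (\<lambda>i. - coord (x m - c) i) = excess L (\<lambda>i. - y A i)"
      using A by (auto intro: deficit_excess_cong)
    have "excess L (y A) \<le> \<delta> m" if "c = v"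
    proof -
      have "coord v 1 \<noteq> coord u 1" by (simp add: u v)
      then have "v \<noteq> u" by blast
      then show ?thesis using excess_x[of m L] that by (simp add: A_def L_def)
    qed
    then show ?thesis
      using c y_bounds[OF sub, of L] \<delta>_nonneg[of m]
      unfolding p gauge_def eq by (auto simp: coord_simps coord_x y01 u v w)
  qed
  have "\<exists>d\<le>1. (\<lambda>n. ?p (x n - c)) \<longlonglongrightarrow> d" if c: "c \<in> {u, v, w}" for c
  proof -
    obtain d where d: "(\<lambda>n. ?p (x n - c)) \<longlonglongrightarrow> d"
      using norm_dist_convergent[OF norm x const_in_cauchy_seqs[OF norm, of c]]
      unfolding convergent_def norm_dist_def by blast
    have "(\<lambda>n. 1 + \<delta> n) \<longlonglongrightarrow> 1 + 0" by (intro tendsto_add tendsto_const \<delta>_lim)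
    from LIMSEQ_le[OF d this] ball[OF c] have "d \<le> 1" by auto
    with d show ?thesis by blast
  qed
  with x show ?thesis unfolding meeting_triples_iff[OF norm] by blast
qed

end

section \<open>Computability of the norm of a decidable forest\<close>

definition pos_part :: "nat \<Rightarrow> nat" where
  "pos_part c = nat (int_decode c)"

definition neg_part :: "nat \<Rightarrow> nat" where
  "neg_part c = nat (- int_decode c)"

lemma int_decode_even_odd: "int_decode (2 * t) = int t" "int_decode (Suc (2 * t)) = - int t - 1"
  by (simp_all add: int_decode_def sum_decode_def)

lemma computable1_pos_part: "computable1 pos_part"
proof -
  have eq: "pos_part n = (\<Sum>k<Suc n. if 2 * k = n then k else 0)" for n
  proof (cases "even n")
    case True
    then obtain t where n: "n = 2 * t" by blast
    have "(\<Sum>k<Suc n. if 2 * k = n then k else 0) = (\<Sum>k<Suc n. if k = t then t else 0)"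
      unfolding n by (intro sum.cong) auto
    then show ?thesis by (simp add: n pos_part_def int_decode_even_odd del: sum.lessThan_Suc)
  next
    case False
    then obtain t where n: "n = Suc (2 * t)" by (metis oddE Suc_eq_plus1)
    have "(\<Sum>k<Suc n. if 2 * k = n then k else 0) = 0"
      using False by (intro sum.neutral) auto
    then show ?thesis by (simp only: n pos_part_def int_decode_even_odd)
  qed
  show ?thesis
    unfolding computable1_iff ext[where f = pos_part, OF eq] by (intro computable_intros)
qed

lemma computable1_neg_part: "computable1 neg_part"
proof -
  have eq: "neg_part n = (\<Sum>k<Suc n. if Suc (2 * k) = n then Suc k else 0)" for n
  proof (cases "even n")
    case True
    then obtain t where n: "n = 2 * t" by blast
    have "(\<Sum>k<Suc n. if Suc (2 * k) = n then Suc k else 0) = 0"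
      using True by (intro sum.neutral) auto
    then show ?thesis by (simp only: n neg_part_def int_decode_even_odd)
  next
    case False
    then obtain t where n: "n = Suc (2 * t)" by (metis oddE Suc_eq_plus1)
    have "(\<Sum>k<Suc n. if Suc (2 * k) = n then Suc k else 0) = (\<Sum>k<Suc n. if k = t then Suc t else 0)"
      unfolding n by (intro sum.cong) auto
    also have "\<dots> = Suc t" by (simp add: n del: sum.lessThan_Suc)
    finally show ?thesis by (simp add: n neg_part_def int_decode_even_odd del: sum.lessThan_Suc)
  qed
  show ?thesis
    unfolding computable1_iff ext[where f = neg_part, OF eq] by (intro computable_intros)
qed

text \<open>
  Signs are avoided by writing the rational with code \<open>c\<close> as \<open>(rat_pos c - rat_neg c) / rat_den c\<close>
  with natural numbers. If the coded denominator is negative, the parts of the numerator are exchanged; if it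
  is 0, the coded rational is 0 by convention.
\<close>
definition rat_pos :: "nat \<Rightarrow> nat" where
  "rat_pos c = (if pos_part (snd (prod_decode c)) = 0
    then if neg_part (snd (prod_decode c)) = 0 then 0 else neg_part (fst (prod_decode c))
    else pos_part (fst (prod_decode c)))"

definition rat_neg :: "nat \<Rightarrow> nat" where
  "rat_neg c = (if pos_part (snd (prod_decode c)) = 0
    then if neg_part (snd (prod_decode c)) = 0 then 0 else pos_part (fst (prod_decode c))
    else neg_part (fst (prod_decode c)))"

definition rat_den :: "nat \<Rightarrow> nat" where
  "rat_den c = (if pos_part (snd (prod_decode c)) + neg_part (snd (prod_decode c)) = 0 then 1
    else pos_part (snd (prod_decode c)) + neg_part (snd (prod_decode c)))"

lemma rat_den_pos: "0 < rat_den c"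
  by (simp add: rat_den_def)

lemma of_rat_nat_to_rat_surj:
  "real_of_rat (nat_to_rat_surj c) = (real (rat_pos c) - real (rat_neg c)) / real (rat_den c)"
proof -
  obtain a b where c: "prod_decode c = (a, b)" by (cases "prod_decode c")
  have "real_of_rat (nat_to_rat_surj c) = real_of_int (int_decode a) / real_of_int (int_decode b)"
    by (simp add: nat_to_rat_surj_def c Fract_of_int_quotient of_rat_divide)
  then show ?thesis
    by (cases "int_decode b" "0 :: int" rule: linorder_cases; cases "0 \<le> int_decode a")
      (auto simp: c rat_pos_def rat_neg_def rat_den_def pos_part_def neg_part_def)
qed

lemmas computable_on_parts = computable1_pos_part[THEN computable_on_comp1]
  computable1_neg_part[THEN computable_on_comp1] computable_on_prod_decode

lemma computable1_rat_pos: "computable1 rat_pos"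
  unfolding computable1_iff rat_pos_def[abs_def] by (intro computable_intros computable_on_parts)

lemma computable1_rat_neg: "computable1 rat_neg"
  unfolding computable1_iff rat_neg_def[abs_def] by (intro computable_intros computable_on_parts)

lemma computable1_rat_den: "computable1 rat_den"
  unfolding computable1_iff rat_den_def[abs_def] by (intro computable_intros computable_on_parts)

text \<open>
  A list is not longer than its code, so the vector with code \<open>n\<close> vanishes at the nodes \<open>s \<ge> n\<close>; the
  nodes \<open>s < n\<close> have the coordinates \<open>s + 2 < n + 2\<close>.
\<close>
definition common_den :: "nat \<Rightarrow> nat" where
  "common_den n = (\<Prod>j<n + 2. rat_den (nth_code n j))"

definition other_dens :: "nat \<Rightarrow> nat \<Rightarrow> nat" where
  "other_dens n i = (\<Prod>j<n + 2. if j = i then 1 else rat_den (nth_code n j))"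

definition coord_pos :: "nat \<Rightarrow> nat \<Rightarrow> nat" where
  "coord_pos n i = rat_pos (nth_code n i) * other_dens n i"

definition coord_neg :: "nat \<Rightarrow> nat \<Rightarrow> nat" where
  "coord_neg n i = rat_neg (nth_code n i) * other_dens n i"

lemma common_den_pos: "0 < common_den n"
  unfolding common_den_def using rat_den_pos by (intro prod_pos) auto

lemma common_den_eq:
  assumes "i < n + 2"
  shows "common_den n = rat_den (nth_code n i) * other_dens n i"
proof -
  have "(\<Prod>j<n + 2. if j = i then rat_den (nth_code n i) else 1) = rat_den (nth_code n i)"
    using assms by (simp add: prod.delta)
  moreover have "common_den n = (\<Prod>j<n + 2. (if j = i then rat_den (nth_code n i) else 1) *
      (if j = i then 1 else rat_den (nth_code n j)))"
    unfolding common_den_def by (intro prod.cong) auto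
  ultimately show ?thesis unfolding other_dens_def prod.distrib by simp
qed

lemma nat_to_rat_surj_0: "nat_to_rat_surj 0 = 0"
  by (simp add: nat_to_rat_surj_def prod_decode_0 int_decode_def sum_decode_def rat_number_collapse)

lemma coord_vec_decode: "coord (vec_decode n) i = of_rat (nat_to_rat_surj (nth_code n i))"
  by (simp add: coord_def vec_decode_def nth_code nth_default_def nat_to_rat_surj_0)

lemma coord_vec_decode_eq_0: "n \<le> i \<Longrightarrow> coord (vec_decode n) i = 0"
  using length_list_decode_le[of n] by (simp add: coord_def vec_decode_def nth_default_def)

lemma coord_vec_decode_fraction:
  assumes "i < n + 2"
  shows "coord (vec_decode n) i = (real (coord_pos n i) - real (coord_neg n i)) / real (common_den n)"
proof -
  have "other_dens n i \<noteq> 0" using common_den_eq[OF assms] common_den_pos[of n] by auto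
  then show ?thesis
    unfolding coord_vec_decode of_rat_nat_to_rat_surj common_den_eq[OF assms] coord_pos_def coord_neg_def
    by (simp flip: left_diff_distrib)
qed

lemmas computable_on_dens = computable1_rat_pos[THEN computable_on_comp1]
  computable1_rat_neg[THEN computable_on_comp1] computable1_rat_den[THEN computable_on_comp1]
  computable_on_nth_code

lemma computable1_common_den: "computable1 common_den"
  unfolding computable1_iff common_den_def[abs_def] by (intro computable_intros computable_on_dens)

lemma computable2_coord_pos: "computable2 coord_pos"
  unfolding computable2_iff coord_pos_def other_dens_def by (intro computable_intros computable_on_dens)

lemma computable2_coord_neg: "computable2 coord_neg"
  unfolding computable2_iff coord_neg_def other_dens_def by (intro computable_intros computable_on_dens)

lemma computable_on_max:
  assumes "computable_on vs F" "computable_on vs G"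
  shows "computable_on vs (\<lambda>e. max (F e) (G e))"
proof -
  have "max x y = x + (y - x)" for x y :: nat by simp
  then show ?thesis by (simp only:) (intro computable_intros assms)
qed

context forest
begin

definition child_indicator :: "nat \<Rightarrow> nat \<Rightarrow> nat" where
  "child_indicator s j = (if child s j then 1 else 0)"

text \<open>
  The gauge of the vector with coordinates \<open>P i - N i\<close>. Truncated subtraction takes over the
  maximum with 0 in deficit and excess.
\<close>
definition nat_gauge :: "nat \<Rightarrow> (nat \<Rightarrow> nat) \<Rightarrow> (nat \<Rightarrow> nat) \<Rightarrow> nat" where
  "nat_gauge L P N =
    max ((\<Sum>j<L. N (j + 2) - P (j + 2)) + P 0 - N 0)
     (max ((\<Sum>s<L. P (s + 2) + 2 * (\<Sum>j<L. child_indicator s j * N (j + 2))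
          - (N (s + 2) + 2 * (\<Sum>j<L. child_indicator s j * P (j + 2)))) + P 1 - N 1)
       (N 0 + N 1 - (P 0 + P 1)))"

text \<open>
  In the outer maximum truncation is harmless as well, since the gauge is nonnegative.
\<close>
lemma gauge_eq_nat_gauge:
  assumes D: "0 < D" and x: "\<And>i. i < L + 2 \<Longrightarrow> x i = (real (P i) - real (N i)) / real D"
  shows "gauge L x = real (nat_gauge L P N) / real D"
proof -
  have trunc: "real (a - b) = max 0 (real a - real b)" for a b :: nat by auto
  have Dx: "real D * x i = real (P i) - real (N i)" if "i < L + 2" for i
    using x[OF that] D by simp
  have out: "real D * outflow L x s = (\<Sum>j<L. real (child_indicator s j) * real (P (j + 2)))
      - (\<Sum>j<L. real (child_indicator s j) * real (N (j + 2)))" for s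
    unfolding outflow_def sum_distrib_left sum_subtractf[symmetric] child_indicator_def
    by (intro sum.cong) (auto simp: Dx)
  have def: "real D * deficit L x = (\<Sum>j<L. real (N (j + 2) - P (j + 2)))"
    unfolding deficit_def sum_distrib_left[of "real D"] trunc using Dx
    by (intro sum.cong) (auto simp flip: max_0_mult)
  have exc: "real D * excess L x = (\<Sum>s<L. real (P (s + 2) + 2 * (\<Sum>j<L. child_indicator s j * N (j + 2))
          - (N (s + 2) + 2 * (\<Sum>j<L. child_indicator s j * P (j + 2)))))"
    unfolding excess_def sum_distrib_left[of "real D"] trunc
  proof (rule sum.cong)
    fix s assume "s \<in> {..<L}"
    then have "real D * (x (s + 2) - 2 * outflow L x s) =
      real (P (s + 2)) - real (N (s + 2)) - 2 * (real D * outflow L x s)"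
      using Dx[of "s + 2"] by (simp add: algebra_simps)
    then show "real D * max 0 (x (s + 2) - 2 * outflow L x s) =
      max 0 (real (P (s + 2) + 2 * (\<Sum>j<L. child_indicator s j * N (j + 2))) -
          real (N (s + 2) + 2 * (\<Sum>j<L. child_indicator s j * P (j + 2))))"
      unfolding out by (simp flip: max_0_mult add: algebra_simps)
  qed simp
  have "real D * gauge L x = max (real D * deficit L x + real D * x 0)
      (max (real D * excess L x + real D * x 1) (- (real D * x 0) - real D * x 1))"
    unfolding gauge_def by (simp add: max_mult_distrib_left algebra_simps)
  moreover have "0 \<le> real D * gauge L x" using gauge_nonneg by simp
  ultimately have "real D * gauge L x = real (nat_gauge L P N)"
    using Dx[of 0] Dx[of 1] unfolding nat_gauge_def def exc of_nat_max trunc[of "_ + _"] of_nat_add of_nat_sum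
    by (simp add: max_def split: if_splits)
  then show ?thesis using D by (simp add: field_simps)
qed

lemma computable1_nat_gauge:
  assumes "decidable2 child" "computable2 P" "computable2 N"
  shows "computable1 (\<lambda>n. nat_gauge n (P n) (N n))"
proof -
  have "computable2 child_indicator"
    using assms(1) by (simp add: decidable2_def child_indicator_def[abs_def])
  note comps = this[THEN computable_on_comp2] assms(2,3)[THEN computable_on_comp2]
  show ?thesis
    unfolding computable1_iff nat_gauge_def by (intro computable_intros computable_on_max comps)
qed

text \<open>
  The values of the norm are rational and computed exactly, so the approximations need not depend on the precision.
\<close>
lemma computable_norm_forest_norm:
  assumes "decidable2 child"
  shows "computable_norm forest_norm"
proof -
  define Q where "Q n = max (nat_gauge n (coord_pos n) (coord_neg n))
    (nat_gauge n (coord_neg n) (coord_pos n))" for n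
  have norm: "forest_norm (vec_decode n) = real (Q n) / real (common_den n)" for n
  proof -
    have "forest_norm (vec_decode n) = max (gauge n (coord (vec_decode n)))
        (gauge n (\<lambda>i. - coord (vec_decode n) i))"
      by (rule forest_norm_eq) (rule coord_vec_decode_eq_0)
    also have "gauge n (coord (vec_decode n)) =
        real (nat_gauge n (coord_pos n) (coord_neg n)) / real (common_den n)"
      by (rule gauge_eq_nat_gauge[OF common_den_pos coord_vec_decode_fraction])
    also have "gauge n (\<lambda>i. - coord (vec_decode n) i) =
        real (nat_gauge n (coord_neg n) (coord_pos n)) / real (common_den n)"
      by (rule gauge_eq_nat_gauge[OF common_den_pos])
        (simp only: coord_vec_decode_fraction minus_divide_left minus_diff_eq)
    finally show ?thesis
      using common_den_pos[of n] by (simp add: Q_def of_nat_max max_divide_distrib_right)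
  qed
  have "nat_to_rat_surj (prod_encode (2 * Q n, 2 * common_den n)) = Fract (int (Q n)) (int (common_den n))" for n
    by (simp add: nat_to_rat_surj_def int_decode_even_odd)
  then have "of_rat (nat_to_rat_surj (prod_encode (2 * Q n, 2 * common_den n))) = forest_norm (vec_decode n)" for n
    by (simp add: norm Fract_of_int_quotient of_rat_divide)
  moreover have "computable2 (\<lambda>n k. prod_encode (2 * Q n, 2 * common_den n))"
    unfolding computable2_iff Q_def
    by (intro computable_on_prod_encode computable_intros computable_on_max
      computable1_nat_gauge[THEN computable_on_comp1] assms computable2_coord_pos computable2_coord_neg
      computable1_common_den[THEN computable_on_comp1])
  ultimately show ?thesis
    unfolding computable_norm_def using is_norm_forest_norm
    by (intro conjI exI[of _ "\<lambda>n k. prod_encode (2 * Q n, 2 * common_den n)"]) auto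
qed

end

section \<open>The forest of finite sequences that avoid a relation\<close>

text \<open>
  The sequence \<open>\<sigma>\<close> in the tree that belongs to \<open>n\<close>. The trees of all \<open>n\<close> form one forest, so that a
  single norm serves all \<open>n\<close>.
\<close>
definition seq_node :: "nat \<Rightarrow> nat list \<Rightarrow> nat" where
  "seq_node n \<sigma> = prod_encode (n, list_encode \<sigma>)"

text \<open>
  Only the parent is tested for \<open>R\<close>: on an infinite path every node is a parent.
\<close>
definition seq_child :: "(nat \<Rightarrow> nat \<Rightarrow> bool) \<Rightarrow> nat \<Rightarrow> nat \<Rightarrow> bool" where
  "seq_child R s j \<longleftrightarrow> (\<exists>n \<sigma> c. s = seq_node n \<sigma> \<and> j = seq_node n (\<sigma> @ [c]) \<and> \<not> R n (list_encode \<sigma>))"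

lemma seq_node_eq_iff: "seq_node n \<sigma> = seq_node m \<tau> \<longleftrightarrow> n = m \<and> \<sigma> = \<tau>"
  by (simp add: seq_node_def list_encode_eq)

lemma prod_encode_strict_mono: "a < b \<Longrightarrow> prod_encode (n, a) < prod_encode (n, b)"
proof -
  have "strict_mono triangle" by (simp add: strict_mono_Suc_iff)
  then show "a < b \<Longrightarrow> prod_encode (n, a) < prod_encode (n, b)"
    by (simp add: prod_encode_def strict_mono_less)
qed

lemma list_encode_snoc_less: "list_encode \<sigma> < list_encode (\<sigma> @ [c])"
  by (induction \<sigma>) (auto intro: prod_encode_strict_mono)

lemma forest_seq_child: "forest (seq_child R)"
proof
  show "s < j" if "seq_child R s j" for s j
    using that list_encode_snoc_less
    by (auto simp: seq_child_def seq_node_def intro: prod_encode_strict_mono)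
  show "s = t" if "seq_child R s j" "seq_child R t j" for s t j
    using that by (auto simp: seq_child_def seq_node_eq_iff)
qed

lemma seq_path_iff:
  "(\<exists>j. j 0 = seq_node n [] \<and> (\<forall>k. seq_child R (j k) (j (Suc k)))) \<longleftrightarrow>
    (\<exists>f. \<forall>k. \<not> R n (list_encode (map f [0..<k])))"
proof
  assume "\<exists>j. j 0 = seq_node n [] \<and> (\<forall>k. seq_child R (j k) (j (Suc k)))"
  then obtain j where j: "j 0 = seq_node n []" "\<And>k. seq_child R (j k) (j (Suc k))" by blast
  define f where "f k = last (list_decode (snd (prod_decode (j (Suc k)))))" for k
  have jk: "j k = seq_node n (map f [0..<k])" for k
  proof (induction k)
    case (Suc k)
    obtain c where "j (Suc k) = seq_node n (map f [0..<k] @ [c])"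
      using j(2)[of k] unfolding Suc seq_child_def by (auto simp: seq_node_eq_iff)
    moreover from this have "f k = c" by (simp add: f_def seq_node_def)
    ultimately show ?case by simp
  qed (simp add: j(1))
  have "\<not> R n (list_encode (map f [0..<k]))" for k
    using j(2)[of k] unfolding jk seq_child_def by (auto simp: seq_node_eq_iff)
  then show "\<exists>f. \<forall>k. \<not> R n (list_encode (map f [0..<k]))" by blast
next
  assume "\<exists>f. \<forall>k. \<not> R n (list_encode (map f [0..<k]))"
  then obtain f where f: "\<And>k. \<not> R n (list_encode (map f [0..<k]))" by blast
  have "seq_child R (seq_node n (map f [0..<k])) (seq_node n (map f [0..<Suc k]))" for k
    unfolding seq_child_def using f[of k] by auto
  then show "\<exists>j. j 0 = seq_node n [] \<and> (\<forall>k. seq_child R (j k) (j (Suc k)))"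
    by (intro exI[of _ "\<lambda>k. seq_node n (map f [0..<k])"]) simp
qed

lemma snoc_iff:
  "(\<exists>c. \<tau> = \<sigma> @ [c]) \<longleftrightarrow>
    length \<tau> = Suc (length \<sigma>) \<and> (\<forall>i<length \<sigma>. nth_default 0 \<sigma> i = nth_default 0 \<tau> i)"
proof
  assume r: "length \<tau> = Suc (length \<sigma>) \<and> (\<forall>i<length \<sigma>. nth_default 0 \<sigma> i = nth_default 0 \<tau> i)"
  then have "butlast \<tau> = \<sigma>"
    by (intro nth_equalityI) (auto simp: nth_butlast nth_default_def)
  moreover have "\<tau> \<noteq> []" using r by auto
  ultimately show "\<exists>c. \<tau> = \<sigma> @ [c]" by (metis append_butlast_last_id)
qed (auto simp: nth_default_def nth_append)

text \<open>
  One sequence extends another by one entry iff the lengths fit and the entries agree below the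
  shorter length, and this is a bounded condition on the codes.
\<close>
lemma decidable2_seq_child:
  assumes "decidable2 R"
  shows "decidable2 (seq_child R)"
proof -
  define ind where "ind x y = (if R x y then 1 else 0 :: nat)" for x y
  have ind: "computable2 ind" using assms by (simp add: decidable2_def ind_def[abs_def])
  have "(if seq_child R s j then 1 else 0 :: nat) =
      (if fst (prod_decode s) = fst (prod_decode j)
       then if ind (fst (prod_decode s)) (snd (prod_decode s)) = 0
         then if length_code (snd (prod_decode j)) = Suc (length_code (snd (prod_decode s)))
           then if (\<Sum>i<length_code (snd (prod_decode s)).
               if nth_code (snd (prod_decode s)) i = nth_code (snd (prod_decode j)) i then 0 else 1) = (0::nat)
             then 1 else 0
           else 0
         else 0
       else 0)" for s j
  proof -
    obtain n \<sigma> where s: "s = seq_node n \<sigma>"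
      by (metis list_decode_inverse prod_decode_inverse seq_node_def surj_pair)
    obtain m \<tau> where j: "j = seq_node m \<tau>"
      by (metis list_decode_inverse prod_decode_inverse seq_node_def surj_pair)
    have "seq_child R s j \<longleftrightarrow> n = m \<and> \<not> R n (list_encode \<sigma>) \<and> (\<exists>c. \<tau> = \<sigma> @ [c])"
      unfolding s j seq_child_def by (auto simp: seq_node_eq_iff)
    moreover have "(\<Sum>i<length \<sigma>. if nth_default 0 \<sigma> i = nth_default 0 \<tau> i then 0 else 1) = (0::nat) \<longleftrightarrow>
        (\<forall>i<length \<sigma>. nth_default 0 \<sigma> i = nth_default 0 \<tau> i)"
      by auto
    ultimately show ?thesis
      unfolding snoc_iff by (simp only: s j seq_node_def length_code nth_code ind_def
        prod_encode_inverse list_encode_inverse fst_conv snd_conv) simp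
  qed
  then show ?thesis
    unfolding decidable2_def computable2_iff
    by (simp only:) (intro computable_intros computable_on_prod_decode computable_on_nth_code
      computable_on_length_code computable_on_comp2[OF ind])
qed

definition rat_code :: "rat \<Rightarrow> nat" where
  "rat_code = inv nat_to_rat_surj"

lemma nat_to_rat_surj_rat_code: "nat_to_rat_surj (rat_code q) = q"
  by (simp add: rat_code_def surj_f_inv_f surj_nat_to_rat_surj)

text \<open>
  The centre whose forest part is \<open>e\<^sub>r / 8\<close>.
\<close>
definition centre_code :: "nat \<Rightarrow> nat" where
  "centre_code r = list_encode (rat_code (- 1) # rat_code (1 / 2) # replicate r 0 @ [rat_code (1 / 8)])"

lemma coord_centre_code:
  "coord (vec_decode (centre_code r)) =
    (\<lambda>i. if i = 0 then - 1 else if i = 1 then 1 / 2 else if i = r + 2 then 1 / 8 else 0)"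
proof
  fix i
  show "coord (vec_decode (centre_code r)) i =
      (if i = 0 then - 1 else if i = 1 then 1 / 2 else if i = r + 2 then 1 / 8 else 0)"
    by (auto simp: coord_vec_decode nth_code centre_code_def nth_default_def nth_append nth_Cons'
      nat_to_rat_surj_rat_code nat_to_rat_surj_0 of_rat_divide of_rat_minus)
qed

lemma coord_pair:
  "coord (vec_decode (list_encode [rat_code a, rat_code b])) =
    (\<lambda>i. if i = 0 then of_rat a else if i = 1 then of_rat b else 0)"
proof
  fix i
  show "coord (vec_decode (list_encode [rat_code a, rat_code b])) i =
      (if i = 0 then of_rat a else if i = 1 then of_rat b else 0)"
    by (auto simp: coord_vec_decode nth_code nth_default_def nth_Cons'
      nat_to_rat_surj_rat_code nat_to_rat_surj_0 simp del: list_encode.simps)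
qed

lemma computable1_centre_code: "computable1 centre_code"
proof -
  have "list_encode (replicate r 0 @ [c]) =
      rec_nat (Suc (prod_encode (c, 0))) (\<lambda>m y. Suc (prod_encode (0, y))) r" for r c
    by (induction r) auto
  then have eq: "centre_code r = Suc (prod_encode (rat_code (- 1), Suc (prod_encode (rat_code (1 / 2),
      rec_nat (Suc (prod_encode (rat_code (1 / 8), 0))) (\<lambda>m y. Suc (prod_encode (0, y))) r))))" for r
    by (simp add: centre_code_def)
  show ?thesis
    unfolding computable1_iff ext[where f = centre_code, OF eq]
    by (intro computable_intros computable_on_prod_encode computable_on_rec)
qed

theorem corollary2p10:
  fixes C :: "nat set"
  assumes "hyperarithmetical C"
  shows "\<exists>p. computable_norm p \<and>
    m_reducible C {t. triple_decode t \<in> meeting_triples p}"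
proof -
  obtain R where R: "decidable2 R" and C: "C = {n. \<exists>f. \<forall>k. \<not> R n (list_encode (map f [0..<k]))}"
  proof -
    obtain P where P: "Pi01 P" "C = {n. \<exists>f. (n, f) \<in> P}"
      using assms unfolding hyperarithmetical_def Sigma11_def by blast
    then obtain R where "decidable2 R" "- P = {(n, f). \<exists>k. R n (list_encode (map f [0..<k]))}"
      unfolding Pi01_def Sigma01_def by blast
    moreover from this(2) have "(n, f) \<in> P \<longleftrightarrow> (\<forall>k. \<not> R n (list_encode (map f [0..<k])))" for n f
      by blast
    ultimately show ?thesis using P(2) that by blast
  qed
  interpret forest "seq_child R" by (rule forest_seq_child)
  define v w where "v = list_encode [rat_code (1 / 2), rat_code (- 1)]"
    and "w = list_encode [rat_code (1 / 2), rat_code (1 / 2)]"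
  define red where "red n = prod_encode (centre_code (prod_encode (n, 0)), prod_encode (v, w))" for n
  have "n \<in> C \<longleftrightarrow> triple_decode (red n) \<in> meeting_triples forest_norm" for n
  proof -
    let ?u = "centre_code (seq_node n [])"
    have "triple_decode (red n) = (vec_decode ?u, vec_decode v, vec_decode w)"
      by (simp add: triple_decode_def red_def seq_node_def)
    moreover have u: "coord (vec_decode ?u) =
        (\<lambda>i. if i = 0 then - 1 else if i = 1 then 1 / 2 else if i = seq_node n [] + 2 then 1 / 8 else 0)"
      by (rule coord_centre_code)
    moreover have vw: "coord (vec_decode v) = (\<lambda>i. if i = 0 then 1 / 2 else if i = 1 then - 1 else 0)"
      "coord (vec_decode w) = (\<lambda>i. if i = 0 then 1 / 2 else if i = 1 then 1 / 2 else 0)"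
      unfolding v_def w_def coord_pair by (simp_all add: of_rat_divide of_rat_minus cong: if_cong)
    ultimately have "triple_decode (red n) \<in> meeting_triples forest_norm \<longleftrightarrow>
        (\<exists>j. j 0 = seq_node n [] \<and> (\<forall>k. seq_child R (j k) (j (Suc k))))"
      using path_if_meeting[OF _ u vw] meeting_if_path[OF _ _ u vw] by auto
    then show ?thesis by (simp add: seq_path_iff C)
  qed
  moreover have "computable1 red"
    unfolding computable1_iff red_def[abs_def]
    by (intro computable_intros computable_on_prod_encode computable_on_comp1[OF computable1_centre_code])
  ultimately have "m_reducible C {t. triple_decode t \<in> meeting_triples forest_norm}"
    unfolding m_reducible_def by auto
  moreover have "computable_norm forest_norm"
    using decidable2_seq_child[OF R] by (rule computable_norm_forest_norm)
  ultimately show ?thesis by blast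
qed

end
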